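(* When the weight functions are allowed to take arbitrary integer values (i.e., $w_i:E\to\mathbb{Z}$), the non-cooperative Nash-rational synthesis problem (NCNS) and the non-cooperative Pareto-rational synthesis problem (NCPS) are undecidable.
   Context: Game. A finite set $V$ of vertices, edges $E\subseteq V\times V$ (each vertex has a successor), an initial vertex $v_0$, players $\mathcal{P}=\{0,1,\dots,t\}$ with a partition $(V_i)_{i\in\mathcal{P}}$ of $V$, weight functions $w_i:E\to\mathbb{Z}$ and target sets $T_i\subseteq V$. For a play (infinite path) $\pi=\pi_0\pi_1\dots$, $\mathrm{cost}_i(\pi)=\sum_{j=1}^n w_i((\pi_{j-1},\pi_j))$ for the least $n$ with $\pi_n\in T_i$, and $+\infty$ if none. A strategy of player $i$ maps histories (finite paths from $v_0$) ending in $V_i$ to a successor of the last vertex; a strategy profile $\sigma$ yields the outcome play $\mathrm{out}(\sigma)$ from $v_0$. NE setting: given $\sigma_0$ of player $0$, a profile $\sigma$ containing $\sigma_0$ is a $\sigma_0$-fixed NE if no player $i\in\{1,\dots,t\}$ can strictly decrease $\mathrm{cost}_i$ of the outcome by changing only his own strategy. NCNS: given the game and $c\in\mathbb{N}$, decide whether there exists $\sigma_0$ such that all $\sigma_0$-fixed NE $\sigma$ satisfy $\mathrm{cost}_0(\mathrm{out}(\sigma))\le c$. PO setting: the environment is a single player $1$ owning all vertices not owned by player $0$, with $t$ target sets $T_1,\dots,T_t$ and weights $w_1,\dots,w_t$, and cost tuple $\mathrm{cost}(\pi)=(\mathrm{cost}_1(\pi),\dots,\mathrm{cost}_t(\pi))$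 compared by the strict componentwise order. Given $\sigma_0$, a play from $v_0$ consistent with $\sigma_0$ is $\sigma_0$-fixed PO if its cost tuple is minimal among cost tuples of plays from $v_0$ consistent with $\sigma_0$. NCPS: given the game and $c\in\mathbb{N}$, decide whether there exists $\sigma_0$ such that every $\sigma_0$-fixed PO play $\pi$ satisfies $\mathrm{cost}_0(\pi)\le c$. *)

theory Defs
  imports Main "HOL-Library.Nat_Bijection" "HOL-Library.Extended_Real"
begin

datatype recf = Z | S | Id nat | Cn recf "recf list" | Pr recf recf | Mn recf

inductive eval :: "recf \<Rightarrow> nat list \<Rightarrow> nat \<Rightarrow> bool" where
  eval_Z: "eval Z xs 0"
| eval_S: "eval S (x # xs) (Suc x)"
| eval_Id: "i < length xs \<Longrightarrow> eval (Id i) xs (xs ! i)"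
| eval_Cn: "list_all2 (\<lambda>g y. eval g xs y) gs ys \<Longrightarrow> eval f ys z \<Longrightarrow> eval (Cn f gs) xs z"
| eval_Pr0: "eval g xs z \<Longrightarrow> eval (Pr g h) (0 # xs) z"
| eval_PrS: "eval (Pr g h) (n # xs) y \<Longrightarrow> eval h (n # y # xs) z \<Longrightarrow> eval (Pr g h) (Suc n # xs) z"
| eval_Mn: "eval f (n # xs) 0 \<Longrightarrow> (\<forall>m<n. \<exists>y. eval f (m # xs) (Suc y)) \<Longrightarrow> eval (Mn f) xs n"

definition decidable_set :: "nat set \<Rightarrow> bool" where
  "decidable_set A \<longleftrightarrow> (\<exists>f. \<forall>n. eval f [n] (if n \<in> A then 1 else 0))"

text \<open>An instance: number of vertices n (vertices are 0..<n), initial vertex,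
  t (players are 0..t), owner list (owner of vertex v is own!v),
  edges (u, v, ws) with ws!i = w_i(u,v), target lists (ts!i = T_i), bound c.\<close>
datatype inst = Inst (nverts: nat) (init: nat) (tpl: nat) (owners: "nat list")
  (edges: "(nat \<times> nat \<times> int list) list") (targets: "nat list list") (bound: nat)

definition enc_edge :: "nat \<times> nat \<times> int list \<Rightarrow> nat" where
  "enc_edge e = (case e of (u, v, ws) \<Rightarrow> list_encode [u, v, list_encode (map int_encode ws)])"

definition encode :: "inst \<Rightarrow> nat" where
  "encode I = list_encode [nverts I, init I, tpl I, list_encode (owners I),
     list_encode (map enc_edge (edges I)), list_encode (map list_encode (targets I)), bound I]"

definition E :: "inst \<Rightarrow> (nat \<times> nat) set" where
  "E I = {(u, v). \<exists>ws. (u, v, ws) \<in> set (edges I)}"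

definition wt :: "inst \<Rightarrow> nat \<Rightarrow> nat \<times> nat \<Rightarrow> int" where
  "wt I i e = (case find (\<lambda>(a, b, _). (a, b) = e) (edges I) of
      Some (_, _, ws) \<Rightarrow> ws ! i | None \<Rightarrow> 0)"

definition owner :: "inst \<Rightarrow> nat \<Rightarrow> nat" where
  "owner I v = owners I ! v"

definition T :: "inst \<Rightarrow> nat \<Rightarrow> nat set" where
  "T I i = set (targets I ! i)"

definition wf_base :: "inst \<Rightarrow> bool" where
  "wf_base I \<longleftrightarrow> init I < nverts I \<and> length (owners I) = nverts I
    \<and> (\<forall>(u, v, ws) \<in> set (edges I). u < nverts I \<and> v < nverts I \<and> length ws = Suc (tpl I))
    \<and> distinct (map (\<lambda>(u, v, _). (u, v)) (edges I))
    \<and> (\<forall>u < nverts I. \<exists>v. (u, v) \<in> E I)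
    \<and> length (targets I) = Suc (tpl I)
    \<and> (\<forall>Ti \<in> set (targets I). \<forall>x \<in> set Ti. x < nverts I)"

definition wf_ne :: "inst \<Rightarrow> bool" where
  "wf_ne I \<longleftrightarrow> wf_base I \<and> (\<forall>p \<in> set (owners I). p \<le> tpl I)"

text \<open>PO setting: owners are player 0 and the environment player 1.\<close>
definition wf_po :: "inst \<Rightarrow> bool" where
  "wf_po I \<longleftrightarrow> wf_base I \<and> (\<forall>p \<in> set (owners I). p \<le> 1)"

definition is_play :: "inst \<Rightarrow> (nat \<Rightarrow> nat) \<Rightarrow> bool" where
  "is_play I \<pi> \<longleftrightarrow> \<pi> 0 = init I \<and> (\<forall>j. (\<pi> j, \<pi> (Suc j)) \<in> E I)"

definition is_history :: "inst \<Rightarrow> nat list \<Rightarrow> bool" where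
  "is_history I h \<longleftrightarrow> h \<noteq> [] \<and> hd h = init I
     \<and> (\<forall>j. Suc j < length h \<longrightarrow> (h ! j, h ! Suc j) \<in> E I)"

definition cost :: "inst \<Rightarrow> nat \<Rightarrow> (nat \<Rightarrow> nat) \<Rightarrow> ereal" where
  "cost I i \<pi> = (if \<exists>n. \<pi> n \<in> T I i
     then ereal (of_int (\<Sum>j < (LEAST n. \<pi> n \<in> T I i). wt I i (\<pi> j, \<pi> (Suc j))))
     else \<infinity>)"

definition is_strategy :: "inst \<Rightarrow> nat \<Rightarrow> (nat list \<Rightarrow> nat) \<Rightarrow> bool" where
  "is_strategy I i \<sigma> \<longleftrightarrow>
     (\<forall>h. is_history I h \<and> owner I (last h) = i \<longrightarrow> (last h, \<sigma> h) \<in> E I)"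

fun hist :: "inst \<Rightarrow> (nat \<Rightarrow> nat list \<Rightarrow> nat) \<Rightarrow> nat \<Rightarrow> nat list" where
  "hist I \<sigma> 0 = [init I]"
| "hist I \<sigma> (Suc k) = hist I \<sigma> k @ [\<sigma> (owner I (last (hist I \<sigma> k))) (hist I \<sigma> k)]"

definition out :: "inst \<Rightarrow> (nat \<Rightarrow> nat list \<Rightarrow> nat) \<Rightarrow> nat \<Rightarrow> nat" where
  "out I \<sigma> k = last (hist I \<sigma> k)"

definition is_profile :: "inst \<Rightarrow> (nat \<Rightarrow> nat list \<Rightarrow> nat) \<Rightarrow> bool" where
  "is_profile I \<sigma> \<longleftrightarrow> (\<forall>i \<le> tpl I. is_strategy I i (\<sigma> i))"

definition fixed_NE :: "inst \<Rightarrow> (nat list \<Rightarrow> nat) \<Rightarrow> (nat \<Rightarrow> nat list \<Rightarrow> nat) \<Rightarrow> bool" where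
  "fixed_NE I \<sigma>0 \<sigma> \<longleftrightarrow> is_profile I \<sigma> \<and> \<sigma> 0 = \<sigma>0 \<and>
     (\<forall>i \<in> {1..tpl I}. \<forall>\<tau>. is_strategy I i \<tau> \<longrightarrow>
        \<not> cost I i (out I (\<sigma>(i := \<tau>))) < cost I i (out I \<sigma>))"

definition NCNS :: "inst \<Rightarrow> bool" where
  "NCNS I \<longleftrightarrow> (\<exists>\<sigma>0. is_strategy I 0 \<sigma>0 \<and>
     (\<forall>\<sigma>. fixed_NE I \<sigma>0 \<sigma> \<longrightarrow> cost I 0 (out I \<sigma>) \<le> ereal (real (bound I))))"

definition consistent :: "inst \<Rightarrow> (nat list \<Rightarrow> nat) \<Rightarrow> (nat \<Rightarrow> nat) \<Rightarrow> bool" where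
  "consistent I \<sigma>0 \<pi> \<longleftrightarrow> is_play I \<pi> \<and>
     (\<forall>k. owner I (\<pi> k) = 0 \<longrightarrow> \<pi> (Suc k) = \<sigma>0 (map \<pi> [0..<Suc k]))"

definition pareto_less :: "inst \<Rightarrow> (nat \<Rightarrow> nat) \<Rightarrow> (nat \<Rightarrow> nat) \<Rightarrow> bool" where
  "pareto_less I \<pi>' \<pi> \<longleftrightarrow> (\<forall>i \<in> {1..tpl I}. cost I i \<pi>' \<le> cost I i \<pi>)
     \<and> (\<exists>i \<in> {1..tpl I}. cost I i \<pi>' < cost I i \<pi>)"

definition fixed_PO :: "inst \<Rightarrow> (nat list \<Rightarrow> nat) \<Rightarrow> (nat \<Rightarrow> nat) \<Rightarrow> bool" where
  "fixed_PO I \<sigma>0 \<pi> \<longleftrightarrow> consistent I \<sigma>0 \<pi> \<and>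
     \<not> (\<exists>\<pi>'. consistent I \<sigma>0 \<pi>' \<and> pareto_less I \<pi>' \<pi>)"

definition NCPS :: "inst \<Rightarrow> bool" where
  "NCPS I \<longleftrightarrow> (\<exists>\<sigma>0. is_strategy I 0 \<sigma>0 \<and>
     (\<forall>\<pi>. fixed_PO I \<sigma>0 \<pi> \<longrightarrow> cost I 0 \<pi> \<le> ereal (real (bound I))))"

end

theory Submission
  imports Defs
begin

text \<open>
  A counter machine is simulated by a game in which player 0 chooses the transitions, starting at
  gates that are passed before the simulation. Each counter is tracked by two weights, for its value
  and for its negation, and each of the target players (dimensions) 2, ..., \<open>t\<close> may quit at a gate
  for cost \<open>-1\<close>. During the simulation the environment may challenge the nonnegativity of a
  component that the last transition checked: a zero test checks the negation, a decrement the
  value. The challenge ends the play with infinite cost for player 0.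
  If the check was sound, the challenged component has cost at least 0, so quitting is a profitable
  deviation (respectively a dominating play); so it is for a simulation that never ends. If it was
  violated, the cost is at most \<open>-2\<close>, and the challenge is stable. In the Nash setting a loop,
  irrelevant to the challenged player, makes all other target players prefer the challenge to
  quitting. In the Pareto setting the other components are infinite, and component 1 counts
  transitions, so that the first violation is undominated. Hence player 0 wins iff the machine has an
  infinite run without violated checks.

  No universal machine is needed. From a decision procedure one compiles a counter
  program that, given in its registers a description of the part of a game that does not depend on
  these registers, decides the whole game and does the opposite. The registers are the weights of
  a single edge, so the code of the game is a simple function of them, and the program
  can be run on the description of its own game.
\<close>

section \<open>Compiling recursive functions to loop programs\<close>

inductive_cases eval_ZE: "eval Z xs z"
inductive_cases eval_SE: "eval S xs z"
inductive_cases eval_IdE: "eval (Id i) xs z"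
inductive_cases eval_CnE: "eval (Cn f gs) xs z"
inductive_cases eval_PrE: "eval (Pr g h) xs z"
inductive_cases eval_Pr0E: "eval (Pr g h) (0 # xs) z"
inductive_cases eval_PrSE: "eval (Pr g h) (Suc n # xs) z"
inductive_cases eval_MnE: "eval (Mn f) xs z"

datatype cmd = Skip | Incr nat | Seq cmd cmd | Loop nat cmd

text \<open>\<open>Loop r c\<close> takes 1 off \<open>r\<close> before every pass and then tests
  \<open>r\<close> anew. If the body leaves \<open>r\<close> alone this is a for loop, as needed for
  \<open>Pr\<close>; if the body rewrites \<open>r\<close> it is a while loop, as needed for
  \<open>Mn\<close>.\<close>

inductive exec :: "cmd \<Rightarrow> (nat \<Rightarrow> nat) \<Rightarrow> (nat \<Rightarrow> nat) \<Rightarrow> bool" where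
  exec_Skip: "exec Skip s s"
| exec_Incr: "exec (Incr r) s (s(r := Suc (s r)))"
| exec_Seq: "exec c s s' \<Longrightarrow> exec c' s' s'' \<Longrightarrow> exec (Seq c c') s s''"
| exec_Loop0: "s r = 0 \<Longrightarrow> exec (Loop r c) s s"
| exec_LoopS: "s r = Suc n \<Longrightarrow> exec c (s(r := n)) s' \<Longrightarrow> exec (Loop r c) s' s'' \<Longrightarrow> exec (Loop r c) s s''"

definition clear :: "nat \<Rightarrow> cmd" where
  "clear r = Loop r Skip"

text \<open>A loop destroys its counter, so the value is moved into two registers at once and then
  moved back from one of them.\<close>

definition copy :: "nat \<Rightarrow> nat \<Rightarrow> nat \<Rightarrow> cmd" where
  "copy a b tmp = Seq (clear b) (Seq (clear tmp)
     (Seq (Loop a (Seq (Incr b) (Incr tmp))) (Loop tmp (Incr a))))"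

lemma exec_clear: "exec (clear r) s (s(r := 0))"
proof -
  have "s r = n \<Longrightarrow> exec (Loop r Skip) s (s(r := 0))" for n
  proof (induction n arbitrary: s)
    case 0
    then have "s(r := 0) = s" by auto
    then show ?case using exec_Loop0[of s r Skip] 0 by simp
  next
    case (Suc n)
    have "exec (Loop r Skip) (s(r := n)) ((s(r := n))(r := 0))" by (rule Suc.IH) simp
    then have "exec (Loop r Skip) (s(r := n)) (s(r := 0))" by (simp only: fun_upd_upd)
    then show ?case by (rule exec_LoopS[of s r n Skip, OF Suc.prems exec_Skip])
  qed
  then show ?thesis by (simp add: clear_def)
qed

lemma exec_move2:
  assumes "a \<noteq> b" "a \<noteq> tmp" "b \<noteq> tmp"
  shows "exec (Loop a (Seq (Incr b) (Incr tmp))) s (s(a := 0, b := s b + s a, tmp := s tmp + s a))"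
proof -
  have "s a = n \<Longrightarrow> exec (Loop a (Seq (Incr b) (Incr tmp))) s (s(a := 0, b := s b + n, tmp := s tmp + n))" for n
  proof (induction n arbitrary: s)
    case 0
    then have *: "s(a := 0, b := s b + 0, tmp := s tmp + 0) = s" by auto
    show ?case unfolding * by (rule exec_Loop0) (rule 0)
  next
    case (Suc n)
    let ?s = "s(a := n, b := Suc (s b), tmp := Suc (s tmp))"
    have 1: "exec (Seq (Incr b) (Incr tmp)) (s(a := n)) ?s"
      using exec_Seq[OF exec_Incr[of b "s(a := n)"] exec_Incr[of tmp]] assms by simp
    have "exec (Loop a (Seq (Incr b) (Incr tmp))) ?s (?s(a := 0, b := ?s b + n, tmp := ?s tmp + n))"
      by (rule Suc.IH) (use assms in simp)
    moreover have "?s(a := 0, b := ?s b + n, tmp := ?s tmp + n) = s(a := 0, b := s b + Suc n, tmp := s tmp + Suc n)"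
      using assms by auto
    ultimately show ?case using exec_LoopS[of s a n, OF Suc.prems 1] by (simp only:)
  qed
  then show ?thesis by simp
qed

lemma exec_move:
  assumes "a \<noteq> b"
  shows "exec (Loop a (Incr b)) s (s(a := 0, b := s b + s a))"
proof -
  have "s a = n \<Longrightarrow> exec (Loop a (Incr b)) s (s(a := 0, b := s b + n))" for n
  proof (induction n arbitrary: s)
    case 0
    then have *: "s(a := 0, b := s b + 0) = s" by auto
    show ?case unfolding * by (rule exec_Loop0) (rule 0)
  next
    case (Suc n)
    let ?s = "s(a := n, b := Suc (s b))"
    have 1: "exec (Incr b) (s(a := n)) ?s"
      using exec_Incr[of b "s(a := n)"] assms by simp
    have "exec (Loop a (Incr b)) ?s (?s(a := 0, b := ?s b + n))"
      by (rule Suc.IH) (use assms in simp)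
    moreover have "?s(a := 0, b := ?s b + n) = s(a := 0, b := s b + Suc n)"
      using assms by auto
    ultimately show ?case using exec_LoopS[of s a n, OF Suc.prems 1] by (simp only:)
  qed
  then show ?thesis by simp
qed

lemma exec_copy:
  assumes "a \<noteq> b" "a \<noteq> tmp" "b \<noteq> tmp"
  shows "exec (copy a b tmp) s (s(b := s a, tmp := 0))"
proof -
  let ?s1 = "s(b := 0, tmp := 0)"
  let ?s2 = "s(a := 0, b := s a, tmp := s a)"
  have 1: "exec (Loop a (Seq (Incr b) (Incr tmp))) ?s1 ?s2"
  proof -
    have "?s1(a := 0, b := ?s1 b + ?s1 a, tmp := ?s1 tmp + ?s1 a) = ?s2"
      using assms by auto
    then show ?thesis using exec_move2[OF assms, of ?s1] by simp
  qed
  have "?s2(tmp := 0, a := ?s2 a + ?s2 tmp) = s(b := s a, tmp := 0)"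
    using assms by auto
  then have 2: "exec (Loop tmp (Incr a)) ?s2 (s(b := s a, tmp := 0))"
    using exec_move[of tmp a ?s2] assms by simp
  show ?thesis unfolding copy_def
    by (rule exec_Seq[OF exec_clear] exec_Seq[OF 1 2])+
qed

fun seqs :: "(nat list \<Rightarrow> nat \<Rightarrow> nat \<Rightarrow> cmd) list \<Rightarrow> nat list \<Rightarrow> nat \<Rightarrow> nat \<Rightarrow> cmd" where
  "seqs [] args res fr = Skip"
| "seqs (c # cs) args res fr = Seq (c args res fr) (seqs cs args (Suc res) fr)"

text \<open>In \<open>compile f args res fr\<close> the registers from \<open>fr\<close> on are scratch space; they need not
  be zero initially, so compiled bodies can be iterated.\<close>
primrec compile :: "recf \<Rightarrow> nat list \<Rightarrow> nat \<Rightarrow> nat \<Rightarrow> cmd" where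
  "compile Z args res fr = clear res"
| "compile S args res fr = Seq (copy (hd args) res fr) (Incr res)"
| "compile (Id i) args res fr = copy (args ! i) res fr"
| "compile (Cn f gs) args res fr =
     Seq (seqs (map compile gs) args fr (fr + length gs))
       (compile f [fr..<fr + length gs] res (fr + length gs))"
| "compile (Pr g h) args res fr =
     Seq (compile g (tl args) res fr) (Seq (clear (Suc fr)) (Seq (copy (hd args) fr (fr + 3))
       (Loop fr (Seq (compile h (Suc fr # res # tl args) (fr + 2) (fr + 3))
          (Seq (copy (fr + 2) res (fr + 3)) (Incr (Suc fr)))))))"
| "compile (Mn f) args res fr =
     Seq (clear res) (Seq (compile f (res # args) fr (Suc fr))
       (Loop fr (Seq (Incr res) (compile f (res # args) fr (Suc fr)))))"

section \<open>Correctness of the compiled programs\<close>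

text \<open>All registers below \<open>fr\<close> other than \<open>res\<close> survive, arguments
  included, so that programs sharing arguments can be chained. \<open>res\<close> must differ from
  the arguments, since it may be written before they are read for the last time.\<close>

definition computes :: "recf \<Rightarrow> bool" where
  "computes f \<longleftrightarrow> (\<forall>xs z args res fr s. eval f xs z \<longrightarrow> map s args = xs \<longrightarrow> set args \<subseteq> {..<fr}
     \<longrightarrow> res < fr \<longrightarrow> res \<notin> set args \<longrightarrow>
     (\<exists>s'. exec (compile f args res fr) s s' \<and> s' res = z \<and> (\<forall>r<fr. r \<noteq> res \<longrightarrow> s' r = s r)))"

lemma computesD:
  assumes "computes f" "eval f xs z" "map s args = xs" "set args \<subseteq> {..<fr}" "res < fr" "res \<notin> set args"
  obtains s' where "exec (compile f args res fr) s s'" "s' res = z" "\<And>r. r < fr \<Longrightarrow> r \<noteq> res \<Longrightarrow> s' r = s r"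
  using assms unfolding computes_def by blast

lemma exec_seqs:
  assumes "list_all2 (\<lambda>g y. eval g xs y) gs ys" "\<forall>g\<in>set gs. computes g"
    "map s args = xs" "set args \<subseteq> {..<res}" "res + length gs \<le> fr"
  shows "\<exists>s'. exec (seqs (map compile gs) args res fr) s s' \<and> map s' [res..<res + length gs] = ys
    \<and> (\<forall>r<res. s' r = s r)"
  using assms
proof (induction gs ys arbitrary: s res rule: list_all2_induct)
  case Nil
  then show ?case by (auto intro: exec_Skip)
next
  case (Cons g gs y ys)
  obtain s1 where 1: "exec (compile g args res fr) s s1" "s1 res = y"
    "\<And>r. r < fr \<Longrightarrow> r \<noteq> res \<Longrightarrow> s1 r = s r"
    by (rule computesD[of g xs y s args fr res]) (use Cons in auto)
  have "map s1 args = xs" using 1(3) Cons.prems by fastforce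
  then obtain s2 where 2: "exec (seqs (map compile gs) args (Suc res) fr) s1 s2"
    "map s2 [Suc res..<Suc res + length gs] = ys" "\<forall>r<Suc res. s2 r = s1 r"
    using Cons.IH[of s1 "Suc res"] Cons.prems by fastforce
  have "exec (seqs (map compile (g # gs)) args res fr) s s2"
    using exec_Seq[OF 1(1) 2(1)] by simp
  moreover have "map s2 [res..<res + length (g # gs)] = y # ys"
  proof -
    have "[res..<res + length (g # gs)] = res # [Suc res..<Suc res + length gs]"
      by (simp add: upt_conv_Cons del: upt_Suc)
    moreover have "s2 res = y" using 2(3) 1(2) by simp
    ultimately show ?thesis using 2(2) by (simp del: upt_Suc)
  qed
  moreover have "\<forall>r<res. s2 r = s r" using 1(3) 2(3) Cons.prems(4) by simp
  ultimately show ?case by (intro exI[of _ s2] conjI)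
qed

text \<open>The index of \<open>P\<close> counts the completed passes and the counter holds the
  number of passes left; every pass has to preserve the counter.\<close>

lemma exec_Loop_invariant:
  assumes "\<And>i s. i < n \<Longrightarrow> P i s \<Longrightarrow> s r = n - i \<Longrightarrow> \<exists>s'. exec c (s(r := n - Suc i)) s' \<and> P (Suc i) s' \<and> s' r = n - Suc i"
    "P 0 s" "s r = n"
  shows "\<exists>s'. exec (Loop r c) s s' \<and> P n s'"
proof -
  have "m \<le> n \<Longrightarrow> P (n - m) s \<Longrightarrow> s r = m \<Longrightarrow> \<exists>s'. exec (Loop r c) s s' \<and> P n s'" for m s
  proof (induction m arbitrary: s)
    case 0
    then show ?case using exec_Loop0[of s r c] by auto
  next
    case (Suc m)
    have "n - Suc (n - Suc m) = m" "Suc (n - Suc m) = n - m" "n - (n - Suc m) = Suc m" "n - Suc m < n"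
      using Suc.prems(1) by auto
    then obtain s' where "exec c (s(r := m)) s'" "P (n - m) s'" "s' r = m"
      using assms(1)[of "n - Suc m" s] Suc.prems by auto
    then show ?case using Suc.IH[of s'] exec_LoopS[of s r m c, OF Suc.prems(3)] Suc.prems(1) by (meson Suc_leD)
  qed
  from this[of n s] show ?thesis using assms by simp
qed

text \<open>Extracts from a derivation the sequence \<open>Y\<close> of intermediate values, to
  which a loop invariant can then refer without knowing that \<open>eval\<close> is
  functional.\<close>

lemma eval_Pr_approx:
  "eval (Pr g h) (n # xs) z \<Longrightarrow> \<exists>Y. Y n = z \<and> eval g xs (Y 0) \<and> (\<forall>i<n. eval h (i # Y i # xs) (Y (Suc i)))"
proof (induction n arbitrary: z)
  case 0
  then show ?case by (auto elim!: eval_Pr0E intro!: exI[of _ "\<lambda>_. z"])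
next
  case (Suc n)
  from Suc.prems obtain y where y: "eval (Pr g h) (n # xs) y" "eval h (n # y # xs) z"
    by (rule eval_PrSE) auto
  from Suc.IH[OF y(1)] obtain Y where "Y n = y" "eval g xs (Y 0)" "\<forall>i<n. eval h (i # Y i # xs) (Y (Suc i))"
    by blast
  then show ?case using y(2) by (intro exI[of _ "Y(Suc n := z)"]) (auto simp: less_Suc_eq)
qed

lemma computes_Cn:
  assumes "computes f" "\<forall>g\<in>set gs. computes g"
  shows "computes (Cn f gs)"
  unfolding computes_def
proof (intro allI impI)
  fix xs z args res fr and s :: "nat \<Rightarrow> nat"
  assume e: "eval (Cn f gs) xs z" and a: "map s args = xs" "set args \<subseteq> {..<fr}" "res < fr" "res \<notin> set args"
  from e obtain ys where ys: "list_all2 (\<lambda>g y. eval g xs y) gs ys" "eval f ys z"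
    by (rule eval_CnE) auto
  from exec_seqs[OF ys(1) assms(2) a(1,2), of "fr + length gs"]
  obtain s1 where 1: "exec (seqs (map compile gs) args fr (fr + length gs)) s s1"
    "map s1 [fr..<fr + length gs] = ys" "\<forall>r<fr. s1 r = s r" by auto
  obtain s2 where 2: "exec (compile f [fr..<fr + length gs] res (fr + length gs)) s1 s2" "s2 res = z"
    "\<And>r. r < fr + length gs \<Longrightarrow> r \<noteq> res \<Longrightarrow> s2 r = s1 r"
    by (rule computesD[OF assms(1) ys(2) 1(2), of "fr + length gs" res]) (use a in auto)
  show "\<exists>s'. exec (compile (Cn f gs) args res fr) s s' \<and> s' res = z \<and> (\<forall>r<fr. r \<noteq> res \<longrightarrow> s' r = s r)"
    using exec_Seq[OF 1(1) 2(1)] 1(3) 2(2,3) by auto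
qed

lemma computes_Pr:
  assumes "computes g" "computes h"
  shows "computes (Pr g h)"
  unfolding computes_def
proof (intro allI impI)
  fix xs z args res fr and s :: "nat \<Rightarrow> nat"
  assume e: "eval (Pr g h) xs z" and a: "map s args = xs" "set args \<subseteq> {..<fr}" "res < fr" "res \<notin> set args"
  from e obtain n xs' where xs: "xs = n # xs'"
    by (rule eval_PrE) auto
  with a obtain r rs where args: "args = r # rs" "s r = n" "map s rs = xs'" by (cases args) auto
  from eval_Pr_approx e xs obtain Y where Y: "Y n = z" "eval g xs' (Y 0)"
    "\<And>i. i < n \<Longrightarrow> eval h (i # Y i # xs') (Y (Suc i))" by blast
  obtain s1 where 1: "exec (compile g rs res fr) s s1" "s1 res = Y 0"
    "\<And>r. r < fr \<Longrightarrow> r \<noteq> res \<Longrightarrow> s1 r = s r"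
    by (rule computesD[OF assms(1) Y(2) args(3), of fr res]) (use a args in auto)
  let ?s3 = "s1(Suc fr := 0, fr := n, fr + 3 := 0)"
  let ?body = "Seq (compile h (Suc fr # res # rs) (fr + 2) (fr + 3))
          (Seq (copy (fr + 2) res (fr + 3)) (Incr (Suc fr)))"
  \<comment> \<open>After \<open>i\<close> passes \<open>res\<close> holds the value of the
    recursion at \<open>i\<close> and \<open>Suc fr\<close> the index itself; \<open>fr\<close>
    counts the passes left, and \<open>fr + 2\<close> receives each new value.\<close>
  define P where "P i u \<longleftrightarrow> u res = Y i \<and> u (Suc fr) = i \<and> (\<forall>r<fr. r \<noteq> res \<longrightarrow> u r = s r)" for i u
  have "\<exists>s'. exec (Loop fr ?body) ?s3 s' \<and> P n s'"
  proof (rule exec_Loop_invariant)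
    fix i and u :: "nat \<Rightarrow> nat"
    assume i: "i < n" and P: "P i u" and u: "u fr = n - i"
    let ?u = "u(fr := n - Suc i)"
    have m: "map ?u (Suc fr # res # rs) = i # Y i # xs'"
    proof -
      have "\<forall>x\<in>set rs. x < fr \<and> x \<noteq> res" using a args by auto
      then have "map ?u rs = map s rs" using P unfolding P_def by auto
      then show ?thesis using P a args unfolding P_def by auto
    qed
    obtain u1 where u1: "exec (compile h (Suc fr # res # rs) (fr + 2) (fr + 3)) ?u u1" "u1 (fr + 2) = Y (Suc i)"
      "\<And>r. r < fr + 3 \<Longrightarrow> r \<noteq> fr + 2 \<Longrightarrow> u1 r = ?u r"
      by (rule computesD[OF assms(2) Y(3)[OF i] m, of "fr + 3" "fr + 2"]) (use a args in auto)
    let ?u2 = "u1(res := u1 (fr + 2), fr + 3 := 0)"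
    have 2: "exec (copy (fr + 2) res (fr + 3)) u1 ?u2"
      by (rule exec_copy) (use a in auto)
    have "exec ?body ?u (?u2(Suc fr := Suc (?u2 (Suc fr))))"
      by (rule exec_Seq[OF u1(1) exec_Seq[OF 2 exec_Incr]])
    moreover have "P (Suc i) (?u2(Suc fr := Suc (?u2 (Suc fr))))"
      using P u1(2,3) a unfolding P_def by auto
    moreover have "(?u2(Suc fr := Suc (?u2 (Suc fr)))) fr = n - Suc i"
      using u1(3)[of fr] a by auto
    ultimately show "\<exists>s'. exec ?body ?u s' \<and> P (Suc i) s' \<and> s' fr = n - Suc i" by blast
  next
    show "P 0 ?s3" using 1 a unfolding P_def by auto
  qed auto
  then obtain s4 where 4: "exec (Loop fr ?body) ?s3 s4" "P n s4" by blast
  have "s1 r = n" using 1(3)[of r] a args by auto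
  then have 3: "exec (copy r fr (fr + 3)) (s1(Suc fr := 0)) ?s3"
    using exec_copy[of r fr "fr + 3" "s1(Suc fr := 0)"] a args by auto
  have "exec (compile (Pr g h) args res fr) s s4"
    using exec_Seq[OF 1(1) exec_Seq[OF exec_clear exec_Seq[OF 3 4(1)]]] args by simp
  then show "\<exists>s'. exec (compile (Pr g h) args res fr) s s' \<and> s' res = z \<and> (\<forall>r<fr. r \<noteq> res \<longrightarrow> s' r = s r)"
    using 4(2) Y(1) unfolding P_def by blast
qed

text \<open>Register \<open>fr\<close> holds the value of \<open>f\<close> at the candidate in
  \<open>res\<close>, so the loop stops at the first zero. The decrement before each pass is
  harmless because the body overwrites \<open>fr\<close>.\<close>

lemma computes_Mn:
  assumes "computes f"
  shows "computes (Mn f)"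
  unfolding computes_def
proof (intro allI impI)
  fix xs z args res fr and s :: "nat \<Rightarrow> nat"
  assume e: "eval (Mn f) xs z" and a: "map s args = xs" "set args \<subseteq> {..<fr}" "res < fr" "res \<notin> set args"
  from e have z: "eval f (z # xs) 0" "\<And>m. m < z \<Longrightarrow> \<exists>y. eval f (m # xs) (Suc y)"
    by (auto elim!: eval_MnE)
  let ?c = "compile f (res # args) fr (Suc fr)"
  have step: "\<exists>u'. exec ?c u u' \<and> u' fr = v \<and> u' res = m \<and> (\<forall>r<fr. r \<noteq> res \<longrightarrow> u' r = s r)"
    if "eval f (m # xs) v" "u res = m" "\<forall>r<fr. r \<noteq> res \<longrightarrow> u r = s r" for u v m
  proof -
    have "map u args = xs" using that a by (auto intro!: map_cong)
    then have "map u (res # args) = m # xs" using that(2) by simp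
    then obtain u' where
      "exec ?c u u'" "u' fr = v" "\<And>r. r < Suc fr \<Longrightarrow> r \<noteq> fr \<Longrightarrow> u' r = u r"
      by (rule computesD[OF assms \<open>eval f (m # xs) v\<close>, of u "res # args" "Suc fr" fr]) (use a in auto)
    then show ?thesis using that a by (intro exI[of _ u']) auto
  qed
  \<comment> \<open>Induction on the number \<open>m\<close> of candidates still ahead: the current
    one is \<open>z - m\<close>, and its value vanishes only for \<open>m = 0\<close>.\<close>
  have loop: "\<exists>u'. exec (Loop fr (Seq (Incr res) ?c)) u u' \<and> u' res = z \<and> (\<forall>r<fr. r \<noteq> res \<longrightarrow> u' r = s r)"
    if "m \<le> z" "eval f ((z - m) # xs) (u fr)" "u fr = 0 \<longleftrightarrow> m = 0" "u res = z - m" "\<forall>r<fr. r \<noteq> res \<longrightarrow> u r = s r" for m u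
    using that
  proof (induction m arbitrary: u)
    case 0
    then show ?case using exec_Loop0[of u fr] by auto
  next
    case (Suc m)
    then obtain v where v: "u fr = Suc v" by (cases "u fr") auto
    have "\<exists>y. eval f ((z - m) # xs) y \<and> (y = 0 \<longleftrightarrow> m = 0)"
      using z(1) z(2)[of "z - m"] Suc.prems(1) by (cases m) auto
    then obtain y where y: "eval f ((z - m) # xs) y" "y = 0 \<longleftrightarrow> m = 0" by blast
    let ?u = "u(fr := v, res := Suc (z - Suc m))"
    have "Suc (z - Suc m) = z - m" using Suc.prems(1) by auto
    then obtain u' where u': "exec ?c ?u u'" "u' fr = y" "u' res = z - m" "\<forall>r<fr. r \<noteq> res \<longrightarrow> u' r = s r"
      using step[OF y(1), of ?u] Suc.prems a by auto
    have "exec (Incr res) (u(fr := v)) ?u"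
      using exec_Incr[of res "u(fr := v)"] Suc.prems a by auto
    then have "exec (Seq (Incr res) ?c) (u(fr := v)) u'" using u'(1) exec_Seq by blast
    moreover obtain u'' where "exec (Loop fr (Seq (Incr res) ?c)) u' u''" "u'' res = z" "\<forall>r<fr. r \<noteq> res \<longrightarrow> u'' r = s r"
      using Suc.IH[of u'] u' y Suc.prems(1) by auto
    ultimately show ?case using exec_LoopS[of u fr v, OF v] by blast
  qed
  have "\<exists>y. eval f (0 # xs) y \<and> (y = 0 \<longleftrightarrow> z = 0)"
    using z(1) z(2)[of 0] by (cases z) auto
  then obtain y where y: "eval f (0 # xs) y" "y = 0 \<longleftrightarrow> z = 0" by blast
  obtain u where u: "exec ?c (s(res := 0)) u" "u fr = y" "u res = 0" "\<forall>r<fr. r \<noteq> res \<longrightarrow> u r = s r"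
    using step[OF y(1), of "s(res := 0)"] by auto
  obtain u' where u': "exec (Loop fr (Seq (Incr res) ?c)) u u'" "u' res = z" "\<forall>r<fr. r \<noteq> res \<longrightarrow> u' r = s r"
    using loop[of z u] u y by auto
  show "\<exists>s'. exec (compile (Mn f) args res fr) s s' \<and> s' res = z \<and> (\<forall>r<fr. r \<noteq> res \<longrightarrow> s' r = s r)"
    using exec_Seq[OF exec_clear exec_Seq[OF u(1) u'(1)]] u' by auto
qed

lemma computes_all: "computes f"
proof (induction f)
  case Z
  show ?case unfolding computes_def
  proof (intro allI impI)
    fix xs z args res fr and s :: "nat \<Rightarrow> nat"
    assume "eval Z xs z"
    then have "z = 0" by (auto elim: eval_ZE)
    then show "\<exists>s'. exec (compile Z args res fr) s s' \<and> s' res = z \<and> (\<forall>r<fr. r \<noteq> res \<longrightarrow> s' r = s r)"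
      using exec_clear[of res s] by auto
  qed
next
  case S
  show ?case unfolding computes_def
  proof (intro allI impI)
    fix xs z args res fr and s :: "nat \<Rightarrow> nat"
    assume e: "eval S xs z" and a: "map s args = xs" "set args \<subseteq> {..<fr}" "res < fr" "res \<notin> set args"
    then obtain r rs where args: "args = r # rs" "z = Suc (s r)" by (auto elim!: eval_SE)
    have "exec (copy r res fr) s (s(res := s r, fr := 0))"
      by (rule exec_copy) (use a args in auto)
    then have "exec (compile S args res fr) s (s(res := Suc (s r), fr := 0))"
      using exec_Seq[OF _ exec_Incr[of res]] args a(3) by (fastforce simp: fun_upd_twist)
    then show "\<exists>s'. exec (compile S args res fr) s s' \<and> s' res = z \<and> (\<forall>r<fr. r \<noteq> res \<longrightarrow> s' r = s r)"
      using args a(3) by (intro exI[of _ "s(res := Suc (s r), fr := 0)"]) auto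
  qed
next
  case (Id i)
  show ?case unfolding computes_def
  proof (intro allI impI)
    fix xs z args res fr and s :: "nat \<Rightarrow> nat"
    assume e: "eval (Id i) xs z" and a: "map s args = xs" "set args \<subseteq> {..<fr}" "res < fr" "res \<notin> set args"
    then have i: "i < length args" "z = s (args ! i)" by (auto elim!: eval_IdE)
    then have "args ! i \<in> set args" by simp
    then have "exec (copy (args ! i) res fr) s (s(res := s (args ! i), fr := 0))"
      by (intro exec_copy) (use a in auto)
    then show "\<exists>s'. exec (compile (Id i) args res fr) s s' \<and> s' res = z \<and> (\<forall>r<fr. r \<noteq> res \<longrightarrow> s' r = s r)"
      using i a(3) by (intro exI[of _ "s(res := s (args ! i), fr := 0)"]) auto
  qed
qed (auto intro: computes_Cn computes_Pr computes_Mn)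

section \<open>Plays, strategies and codes of vertices\<close>

lemma hist_eq_map_out: "hist I \<sigma> k = map (out I \<sigma>) [0..<Suc k]"
proof (induction k)
  case (Suc k)
  have "hist I \<sigma> (Suc k) = hist I \<sigma> k @ [out I \<sigma> (Suc k)]" by (simp add: out_def)
  then have "hist I \<sigma> (Suc k) = map (out I \<sigma>) [0..<Suc k] @ [out I \<sigma> (Suc k)]"
    unfolding Suc.IH .
  then show ?case by (simp only: upt_Suc_append[OF le0] map_append list.map)
qed (simp add: out_def)

lemma out_Suc: "out I \<sigma> (Suc k) = \<sigma> (owner I (out I \<sigma> k)) (map (out I \<sigma>) [0..<Suc k])"
proof -
  have "out I \<sigma> (Suc k) = \<sigma> (owner I (last (hist I \<sigma> k))) (hist I \<sigma> k)"
    unfolding out_def[of I \<sigma> "Suc k"] by simp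
  then show ?thesis by (metis hist_eq_map_out out_def)
qed

lemma out_0: "out I \<sigma> 0 = init I"
  by (simp add: out_def)

lemma is_history_map:
  assumes "\<pi> 0 = init I" "\<And>j. j < k \<Longrightarrow> (\<pi> j, \<pi> (Suc j)) \<in> E I"
  shows "is_history I (map \<pi> [0..<Suc k])"
proof -
  have "hd (map \<pi> [0..<Suc k]) = \<pi> 0"
    by (simp add: upt_conv_Cons del: upt_Suc)
  then show ?thesis using assms unfolding is_history_def by (auto simp del: upt_Suc)
qed

lemma E_verts: "wf_base I \<Longrightarrow> (u, v) \<in> E I \<Longrightarrow> u < nverts I \<and> v < nverts I"
  unfolding wf_base_def E_def by fastforce

lemma history_last_less:
  assumes "wf_base I" "is_history I h"
  shows "last h < nverts I"
proof (cases "length h = 1")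
  case True
  then obtain x where "h = [x]" by (metis One_nat_def length_0_conv length_Suc_conv)
  then show ?thesis using assms unfolding wf_base_def is_history_def by auto
next
  case False
  then have "(h ! (length h - 2), h ! Suc (length h - 2)) \<in> E I"
    using assms(2) unfolding is_history_def by (metis One_nat_def Suc_diff_Suc Suc_lessI diff_less length_greater_0_conv numeral_2_eq_2 zero_less_Suc)
  moreover have "h ! Suc (length h - 2) = last h"
    using False assms(2) unfolding is_history_def
    by (metis One_nat_def Suc_diff_Suc Suc_lessI last_conv_nth length_greater_0_conv numeral_2_eq_2)
  ultimately show ?thesis using E_verts[OF assms(1)] by metis
qed

lemma out_consistent:
  assumes "wf_ne I" "is_profile I \<sigma>"
  shows "consistent I (\<sigma> 0) (out I \<sigma>)"
proof -
  have wf: "wf_base I" using assms(1) unfolding wf_ne_def by simp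
  have "(out I \<sigma> k, out I \<sigma> (Suc k)) \<in> E I" for k
  proof (induction k rule: less_induct)
    case (less k)
    let ?h = "map (out I \<sigma>) [0..<Suc k]"
    have h: "is_history I ?h" by (rule is_history_map) (auto simp: out_0 less)
    have l: "last ?h = out I \<sigma> k" by simp
    have "out I \<sigma> k < nverts I" using history_last_less[OF wf h] l by simp
    then have "owner I (out I \<sigma> k) \<le> tpl I"
      using assms(1) unfolding wf_ne_def wf_base_def owner_def by auto
    then have "is_strategy I (owner I (out I \<sigma> k)) (\<sigma> (owner I (out I \<sigma> k)))"
      using assms(2) unfolding is_profile_def by blast
    then have "(last ?h, \<sigma> (owner I (out I \<sigma> k)) ?h) \<in> E I"
      using h l unfolding is_strategy_def by metis
    then show ?case unfolding out_Suc l .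
  qed
  then show ?thesis unfolding consistent_def is_play_def using out_Suc out_0 by metis
qed

text \<open>The environment keeps to \<open>\<beta>\<close> as long as the history is a prefix of
  it. Elsewhere any successor will do: the equilibria built from it need no punishment of
  deviations.\<close>

definition follow_play :: "inst \<Rightarrow> (nat list \<Rightarrow> nat) \<Rightarrow> (nat \<Rightarrow> nat) \<Rightarrow> nat \<Rightarrow> nat list \<Rightarrow> nat" where
  "follow_play I \<sigma>0 \<beta> p h = (if p = 0 then \<sigma>0 h else if h = map \<beta> [0..<length h]
     then \<beta> (length h) else (SOME v. (last h, v) \<in> E I))"

lemma some_successor:
  assumes "wf_base I" "is_history I h"
  shows "(last h, SOME v. (last h, v) \<in> E I) \<in> E I"
  using history_last_less[OF assms] assms(1) unfolding wf_base_def by (meson someI_ex)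

lemma is_profile_follow_play:
  assumes "wf_base I" "is_strategy I 0 \<sigma>0" "consistent I \<sigma>0 \<beta>"
  shows "is_profile I (follow_play I \<sigma>0 \<beta>)"
  unfolding is_profile_def
proof (intro allI impI)
  fix p assume "p \<le> tpl I"
  show "is_strategy I p (follow_play I \<sigma>0 \<beta> p)"
  proof (cases "p = 0")
    case True
    then have "follow_play I \<sigma>0 \<beta> p = \<sigma>0" by (simp add: follow_play_def fun_eq_iff)
    then show ?thesis using assms(2) True by simp
  next
    case False
    show ?thesis unfolding is_strategy_def
    proof (intro allI impI)
      fix h assume h: "is_history I h \<and> owner I (last h) = p"
      show "(last h, follow_play I \<sigma>0 \<beta> p h) \<in> E I"
      proof (cases "h = map \<beta> [0..<length h]")
        case True
        have "h \<noteq> []" using h unfolding is_history_def by blast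
        then obtain m where m: "length h = Suc m" by (cases h) auto
        then have "last h = \<beta> m" using True by (metis last_map last_upt upt_conv_Nil  diff_Suc_1 list.simps(3) upt_Suc_append zero_less_Suc length_0_conv length_upt nat.simps(3) zero_le append_is_Nil_conv)
        then show ?thesis using assms(3) True False m
          unfolding follow_play_def consistent_def is_play_def by simp
      next
        case nT: False
        then show ?thesis using some_successor[OF assms(1)] h False unfolding follow_play_def by simp
      qed
    qed
  qed
qed

lemma follow_play_prefix:
  assumes "consistent I \<sigma>0 \<beta>" "map \<pi> [0..<Suc k] = map \<beta> [0..<Suc k]"
  shows "follow_play I \<sigma>0 \<beta> (owner I (\<pi> k)) (map \<pi> [0..<Suc k]) = \<beta> (Suc k)"
proof -
  have "\<pi> k = \<beta> k" using assms(2) by simp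
  then show ?thesis using assms(1) unfolding assms(2) follow_play_def consistent_def
    by (simp del: upt_Suc)
qed

lemma out_follow_play:
  assumes "consistent I \<sigma>0 \<beta>"
  shows "out I (follow_play I \<sigma>0 \<beta>) = \<beta>"
proof -
  let ?\<sigma> = "follow_play I \<sigma>0 \<beta>"
  have "map (out I ?\<sigma>) [0..<Suc k] = map \<beta> [0..<Suc k]" for k
  proof (induction k)
    case 0
    show ?case using assms by (simp add: out_0 consistent_def is_play_def)
  next
    case (Suc k)
    then show ?case using out_Suc[of I ?\<sigma> k] follow_play_prefix[OF assms Suc] by simp
  qed
  then have "out I ?\<sigma> k = \<beta> k" for k
    using map_eq_conv[of "out I ?\<sigma>" "[0..<Suc k]" \<beta>] by auto
  then show ?thesis by (simp add: fun_eq_iff)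
qed

section \<open>Accumulated weights and costs\<close>

definition acc :: "inst \<Rightarrow> (nat \<Rightarrow> nat) \<Rightarrow> nat \<Rightarrow> nat \<Rightarrow> int" where
  "acc I \<pi> i n = (\<Sum>j<n. wt I i (\<pi> j, \<pi> (Suc j)))"

lemma acc_Suc: "acc I \<pi> i (Suc n) = acc I \<pi> i n + wt I i (\<pi> n, \<pi> (Suc n))"
  by (simp add: acc_def)

lemma cost_first:
  assumes "\<pi> m \<in> T I i" "\<And>j. j < m \<Longrightarrow> \<pi> j \<notin> T I i"
  shows "cost I i \<pi> = ereal (of_int (acc I \<pi> i m))"
proof -
  have "(LEAST n. \<pi> n \<in> T I i) = m"
    using assms by (intro Least_equality) (auto simp: not_less[symmetric])
  then show ?thesis using assms(1) unfolding cost_def acc_def by auto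
qed

lemma cost_infinite: "(\<And>n. \<pi> n \<notin> T I i) \<Longrightarrow> cost I i \<pi> = \<infinity>"
  by (simp add: cost_def)

section \<open>Numbering of the vertices\<close>

text \<open>A play passes \<open>Gate 2\<close>, ..., \<open>Gate t\<close>, \<open>Gate 0\<close>
  and then alternates between \<open>State\<close> and \<open>Trans\<close>. A challenge leads from
  \<open>Trans\<close> to \<open>Chal i\<close> and, perhaps after some loops there, to
  \<open>Fin i\<close>. Whoever quits at a gate moves to \<open>Quit 0\<close>.\<close>

datatype vert = Gate nat | State nat | Trans nat | Chal nat | Fin nat | Quit nat

fun venc :: "vert \<Rightarrow> nat" where
  "venc (Gate a) = 6 * a"
| "venc (State a) = 6 * a + 1"
| "venc (Trans a) = 6 * a + 2"
| "venc (Chal a) = 6 * a + 3"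
| "venc (Fin a) = 6 * a + 4"
| "venc (Quit a) = 6 * a + 5"

definition vdec :: "nat \<Rightarrow> vert" where
  "vdec n = ([Gate, State, Trans, Chal, Fin, Quit] ! (n mod 6)) (n div 6)"

lemma vdec_venc [simp]: "vdec (venc x) = x"
proof -
  have "(6 * a + c) mod 6 = c" "(6 * a + c) div 6 = a" if "c < 6" for a c :: nat
    using that by auto
  from this[of 0] this[of 1] this[of 2] this[of 3] this[of 4] this[of 5] show ?thesis
    by (cases x) (simp_all add: vdec_def nth_Cons')
qed

lemma venc_vdec [simp]: "venc (vdec n) = n"
proof -
  have "n mod 6 < 6" by simp
  then consider "n mod 6 = 0" | "n mod 6 = 1" | "n mod 6 = 2" | "n mod 6 = 3" | "n mod 6 = 4" | "n mod 6 = 5"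
    by linarith
  then show ?thesis using div_mult_mod_eq[of n 6]
    by cases (simp_all add: vdec_def nth_Cons' mult.commute)
qed

fun vidx :: "vert \<Rightarrow> nat" where
  "vidx (Gate a) = a" | "vidx (State a) = a" | "vidx (Trans a) = a"
| "vidx (Chal a) = a" | "vidx (Fin a) = a" | "vidx (Quit a) = a"

text \<open>The vertices of all six kinds with index below \<open>B\<close> fill an initial segment
  of the numbers, as an instance requires.\<close>

lemma venc_less: "venc x < 6 * B \<longleftrightarrow> vidx x < B"
  by (cases x) auto

section \<open>The game of a checked vector machine\<close>

text \<open>A machine on integer vectors with transitions \<open>0..<nT\<close>: transition
  \<open>k\<close> adds \<open>dlt k\<close>, and afterwards the components in \<open>chk k\<close>
  should be nonnegative. \<open>ne\<close> selects the Nash setting, its negation the Pareto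
  setting.\<close>

locale arena =
  fixes t nT B :: nat and src dst :: "nat \<Rightarrow> nat" and chk :: "nat \<Rightarrow> nat set"
    and dlt :: "nat \<Rightarrow> nat \<Rightarrow> int" and x0 :: "nat \<Rightarrow> int" and ne :: bool
begin

text \<open>Vertex numbers whose index lies outside the intended range are unreachable; self-loops
  give them a successor.\<close>
fun edge :: "vert \<Rightarrow> vert \<Rightarrow> bool" where
  "edge (Gate a) y = (if a = 0 then y = State 0
     else if 2 \<le> a \<and> a \<le> t then y = Quit 0 \<or> y = (if a = t then Gate 0 else Gate (Suc a))
     else y = Gate a)"
| "edge (State p) y = (if \<exists>k<nT. src k = p then \<exists>k<nT. src k = p \<and> y = Trans k else y = State p)"
| "edge (Trans k) y = (if k < nT then y = State (dst k) \<or> (\<exists>i\<in>chk k. y = Chal i) else y = Trans k)"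
| "edge (Chal i) y = (y = Chal i \<or> y = Fin i)"
| "edge (Fin i) y = (y = Fin i)"
| "edge (Quit i) y = (y = Quit i)"

text \<open>The counters are doubled, so that the cost \<open>-1\<close> of quitting separates honest
  values (at least 0) from violated checks (at most \<open>-2\<close>).\<close>
fun wgt :: "vert \<Rightarrow> vert \<Rightarrow> nat \<Rightarrow> int" where
  "wgt (Gate a) y i = (if 2 \<le> i \<and> y = Quit 0 then -1 else 0)"
| "wgt (State p) y i = (case y of Trans k \<Rightarrow> if i = 1 then 1 else if 2 \<le> i then 2 * dlt k i else 0 | _ \<Rightarrow> 0)"
| "wgt (Chal a) y i = (if y = Chal a \<and> 2 \<le> i \<and> i \<noteq> a then -1 else 0)"
| "wgt _ y i = 0"

text \<open>Player 1 decides on the challenges. In the Nash setting \<open>Gate a\<close> is the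
  only vertex of player \<open>a\<close> for \<open>a\<close> from 2 to \<open>t\<close>, so
  quitting there is the only way to deviate.\<close>

definition own :: "nat \<Rightarrow> nat" where
  "own v = (case vdec v of State _ \<Rightarrow> 0 | Gate a \<Rightarrow> if ne \<and> 2 \<le> a \<and> a \<le> t then a else 1 | _ \<Rightarrow> 1)"

text \<open>The edge from \<open>Gate 0\<close> to \<open>State 0\<close>, whose numbers are 0 and
  1. The initial vector enters the game here only; keeping the edge apart leaves
  \<open>other_edges\<close> independent of \<open>x0\<close>.\<close>

definition start_edge :: "nat \<times> nat \<times> int list" where
  "start_edge = (0, 1, map (\<lambda>i. if 2 \<le> i then 2 * x0 i else 0) [0..<Suc t])"

definition other_edges :: "(nat \<times> nat \<times> int list) list" where
  "other_edges = map (\<lambda>(u, v). (u, v, map (wgt (vdec u) (vdec v)) [0..<Suc t]))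
     (filter (\<lambda>(u, v). edge (vdec u) (vdec v) \<and> (u, v) \<noteq> (0, 1))
       (List.product [0..<6 * B] [0..<6 * B]))"

definition ends :: "nat list" where
  "ends = venc (Quit 0) # map (venc \<circ> Fin) [0..<B]"

text \<open>Player 0 pays 0 after quitting and infinity otherwise. In the Nash setting the target of
  player 1 is the initial vertex, which makes this player indifferent. In the Pareto setting
  component 1 is read at every end, but a component \<open>i\<close> from 2 on only after quitting
  or at its own challenge.\<close>

definition tgt :: "nat \<Rightarrow> nat list" where
  "tgt i = (if i = 0 then [venc (Quit 0)] else if i = 1 then (if ne then [venc (Gate 2)] else ends)
     else if ne then ends else [venc (Quit 0), venc (Fin i)])"

definition G :: inst where
  "G = Inst (6 * B) (venc (Gate 2)) t (map own [0..<6 * B]) (start_edge # other_edges)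
     (map tgt [0..<Suc t]) 0"

definition wx :: "vert \<Rightarrow> vert \<Rightarrow> nat \<Rightarrow> int" where
  "wx x y i = (if x = Gate 0 \<and> y = State 0 then (if 2 \<le> i then 2 * x0 i else 0) else wgt x y i)"

definition run :: "(nat \<Rightarrow> nat) \<Rightarrow> bool" where
  "run ks \<longleftrightarrow> src (ks 0) = 0 \<and> (\<forall>n. ks n < nT \<and> src (ks (Suc n)) = dst (ks n))"

definition vec :: "(nat \<Rightarrow> nat) \<Rightarrow> nat \<Rightarrow> nat \<Rightarrow> int" where
  "vec ks n i = x0 i + (\<Sum>j<n. dlt (ks j) i)"

text \<open>The check concerns the vector after the transition: a decrement of 0 shows up as -1, and
  a zero test of a positive register as its negation.\<close>

definition honest :: "(nat \<Rightarrow> nat) \<Rightarrow> bool" where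
  "honest ks \<longleftrightarrow> (\<forall>n. \<forall>i\<in>chk (ks n). 0 \<le> vec ks (Suc n) i)"

text \<open>The main play, with neither quitting nor challenge: gates 2 to \<open>t\<close> at
  positions 0 to \<open>t - 2\<close>, \<open>Gate 0\<close> at \<open>t - 1\<close>, then the state
  and the transition of step \<open>n\<close> at positions \<open>t + 2 * n\<close> and
  \<open>t + 2 * n + 1\<close>.\<close>

definition \<mu> :: "(nat \<Rightarrow> nat) \<Rightarrow> nat \<Rightarrow> vert" where
  "\<mu> ks j = (if Suc j < t then Gate (j + 2) else if Suc j = t then Gate 0
     else if even (j - t) then State (src (ks ((j - t) div 2))) else Trans (ks ((j - t) div 2)))"

text \<open>Only histories of the main play are constrained, since player 0 has no choice after
  quitting or a challenge.\<close>

definition follow :: "(nat list \<Rightarrow> nat) \<Rightarrow> (nat \<Rightarrow> nat) \<Rightarrow> bool" where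
  "follow \<sigma>0 ks \<longleftrightarrow>
     (\<forall>n. \<sigma>0 (map (venc \<circ> \<mu> ks) [0..<Suc (t + 2 * n)]) = venc (Trans (ks n)))"

text \<open>The number of transitions paid for on the first \<open>j\<close> edges of the main play;
  a transition is paid on entering its \<open>Trans\<close> vertex, and truncated subtraction gives
  0 before the simulation.\<close>

definition cnt :: "nat \<Rightarrow> nat" where
  "cnt j = (j + 1 - t) div 2"

end

text \<open>The assumptions \<open>total\<close> give a transition out of every state that a run can
  reach, so each strategy of player 0 traces out an infinite run, sound or not.\<close>

locale arena_wf = arena +
  assumes t: "2 \<le> t" "t < B"
    and nT: "nT \<le> B"
    and bounds: "\<And>k. k < nT \<Longrightarrow> src k < B \<and> dst k < B"
    and chk: "\<And>k. k < nT \<Longrightarrow> chk k \<subseteq> {2..t}"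
    and total: "\<exists>k<nT. src k = 0" "\<And>k. k < nT \<Longrightarrow> \<exists>k'<nT. src k' = dst k"
begin

section \<open>Well-formedness of the game\<close>

lemma edge_bounded: "edge x y \<Longrightarrow> vidx x < B \<Longrightarrow> vidx y < B"
  using t nT bounds chk by (cases x) (fastforce split: if_splits)+

lemma edge_total: "\<exists>y. edge x y"
  by (cases x) auto

lemma vdec_01 [simp]: "vdec 0 = Gate 0" "vdec 1 = State 0" "vdec (Suc 0) = State 0"
  using vdec_venc[of "Gate 0"] vdec_venc[of "State 0"] by simp_all

lemma vdec_eq_iff: "vdec u = x \<longleftrightarrow> u = venc x"
  by auto

lemma mem_other: "(u, v, ws) \<in> set other_edges \<longleftrightarrow> u < 6 * B \<and> v < 6 * B \<and> edge (vdec u) (vdec v)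
    \<and> (u, v) \<noteq> (0, 1) \<and> ws = map (wgt (vdec u) (vdec v)) [0..<Suc t]"
  unfolding other_edges_def by (auto simp del: upt_Suc)

lemma E_G: "(u, v) \<in> E G \<longleftrightarrow> u < 6 * B \<and> v < 6 * B \<and> edge (vdec u) (vdec v)"
proof -
  have "(u, v) \<in> E G \<longleftrightarrow> (u, v) = (0, 1) \<or>
      u < 6 * B \<and> v < 6 * B \<and> edge (vdec u) (vdec v) \<and> (u, v) \<noteq> (0, 1)"
    unfolding E_def G_def by (auto simp: mem_other start_edge_def simp del: upt_Suc)
  moreover have "edge (vdec 0) (vdec 1)" by simp
  ultimately show ?thesis using t by auto
qed

lemma distinct_edges: "distinct (map (\<lambda>(u, v, _). (u, v)) (start_edge # other_edges))"
proof -
  have "map (\<lambda>(u, v, _). (u, v)) other_edges =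
     filter (\<lambda>(u, v). edge (vdec u) (vdec v) \<and> (u, v) \<noteq> (0, 1)) (List.product [0..<6 * B] [0..<6 * B])"
    unfolding other_edges_def by (simp add: comp_def case_prod_unfold)
  then show ?thesis by (auto simp: start_edge_def distinct_product)
qed

lemma find_distinct:
  assumes "distinct (map (\<lambda>(u, v, _). (u, v)) es)" "(u, v, ws) \<in> set es"
  shows "find (\<lambda>(a, b, _). (a, b) = (u, v)) es = Some (u, v, ws)"
  using assms
proof (induction es)
  case (Cons e es)
  obtain a b w where e: "e = (a, b, w)" by (cases e)
  show ?case
  proof (cases "(a, b) = (u, v)")
    case True
    then have "(u, v, ws) \<notin> set es" using Cons.prems(1) e by (force simp: image_iff)
    then show ?thesis using Cons.prems(2) True e by auto
  next
    case False
    then show ?thesis using Cons e by auto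
  qed
qed simp

lemma wt_G:
  assumes "(u, v) \<in> E G" "i \<le> t"
  shows "wt G i (u, v) = wx (vdec u) (vdec v) i"
proof -
  define ws where "ws = (if (u, v) = (0, 1) then map (\<lambda>i. if 2 \<le> i then 2 * x0 i else 0) [0..<Suc t]
     else map (wgt (vdec u) (vdec v)) [0..<Suc t])"
  have "(u, v, ws) \<in> set (start_edge # other_edges)"
    using assms(1) by (auto simp: ws_def start_edge_def mem_other E_G simp del: upt_Suc)
  from find_distinct[OF distinct_edges this]
  have "wt G i (u, v) = ws ! i" by (simp add: wt_def G_def)
  then show ?thesis using assms(2)
    by (auto simp: ws_def wx_def vdec_eq_iff nth_append simp del: upt_Suc)
qed

lemma wf_base_G: "wf_base G"
  unfolding wf_base_def
proof (intro conjI)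
  show "\<forall>(u, v, ws) \<in> set (edges G). u < nverts G \<and> v < nverts G \<and> length ws = Suc (tpl G)"
    using t by (auto simp: G_def mem_other start_edge_def simp del: upt_Suc)
  show "distinct (map (\<lambda>(u, v, _). (u, v)) (edges G))"
    using distinct_edges by (simp add: G_def)
  show "\<forall>u < nverts G. \<exists>v. (u, v) \<in> E G"
  proof (intro allI impI)
    fix u assume "u < nverts G"
    then have u: "u < 6 * B" by (simp add: G_def)
    obtain y where y: "edge (vdec u) y" using edge_total by blast
    have "vidx (vdec u) < B" using u venc_less[of "vdec u"] by simp
    then have "venc y < 6 * B" using edge_bounded[OF y] venc_less by blast
    then have "(u, venc y) \<in> E G" using u y by (simp add: E_G)
    then show "\<exists>v. (u, v) \<in> E G" ..
  qed
  show "\<forall>Ti \<in> set (targets G). \<forall>x \<in> set Ti. x < nverts G"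
    using t by (auto simp: G_def tgt_def ends_def simp del: upt_Suc)
qed (use t in \<open>auto simp: G_def\<close>)

lemma G_simps: "tpl G = t" "init G = venc (Gate 2)" "bound G = 0"
  by (simp_all add: G_def)

lemma owner_G: "v < 6 * B \<Longrightarrow> owner G v = own v"
  by (simp add: owner_def G_def)

lemma own_le: "own v \<le> (if ne then t else 1)"
  using t by (auto simp: own_def split: vert.split)

lemma owners_G: "p \<in> set (owners G) \<Longrightarrow> \<exists>v. p = own v"
  by (auto simp: G_def)

lemma wf_ne_G: "ne \<Longrightarrow> wf_ne G"
  using own_le wf_base_G owners_G G_simps(1) unfolding wf_ne_def by metis

lemma wf_po_G: "\<not> ne \<Longrightarrow> wf_po G"
  using own_le wf_base_G owners_G unfolding wf_po_def by metis

lemma owner_0_iff: "v < 6 * B \<Longrightarrow> owner G v = 0 \<longleftrightarrow> (\<exists>p. vdec v = State p)"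
  by (auto simp: owner_G own_def split: vert.split)

lemma play_bound: "is_play G \<pi> \<Longrightarrow> \<pi> j < 6 * B"
  unfolding is_play_def using E_G by blast

lemma play_edge: "is_play G \<pi> \<Longrightarrow> edge (vdec (\<pi> j)) (vdec (\<pi> (Suc j)))"
  unfolding is_play_def using E_G by blast

lemma play_0: "is_play G \<pi> \<Longrightarrow> vdec (\<pi> 0) = Gate 2"
  unfolding is_play_def G_simps by (metis vdec_venc)

lemma acc_G_Suc:
  assumes "is_play G \<pi>" "i \<le> t"
  shows "acc G \<pi> i (Suc n) = acc G \<pi> i n + wx (vdec (\<pi> n)) (vdec (\<pi> (Suc n))) i"
  using assms wt_G unfolding acc_Suc is_play_def by metis

section \<open>The main play and departures from it\<close>

lemma \<mu>_cases:
  obtains (gate) "Suc j < t" "\<mu> ks j = Gate (j + 2)" "\<mu> ks (Suc j) = (if j + 2 = t then Gate 0 else Gate (j + 3))"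
      "cnt j = 0" "cnt (Suc j) = 0"
  | (start) "Suc j = t" "\<mu> ks j = Gate 0" "\<mu> ks (Suc j) = State (src (ks 0))" "cnt j = 0" "cnt (Suc j) = 0"
  | (state) n where "j = t + 2 * n" "\<mu> ks j = State (src (ks n))" "\<mu> ks (Suc j) = Trans (ks n)"
      "cnt j = n" "cnt (Suc j) = Suc n"
  | (trans) n where "j = t + 2 * n + 1" "\<mu> ks j = Trans (ks n)" "\<mu> ks (Suc j) = State (src (ks (Suc n)))"
      "cnt j = Suc n" "cnt (Suc j) = Suc n"
proof -
  consider "Suc j < t" | "Suc j = t" | n where "j = t + 2 * n" | n where "j = t + 2 * n + 1"
  proof -
    have "t \<le> j \<Longrightarrow> (\<exists>n. j = t + 2 * n) \<or> (\<exists>n. j = t + 2 * n + 1)" by presburger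
    then show ?thesis using that by (meson leI le_antisym not_less_eq_eq Suc_leI)
  qed
  then show ?thesis
  proof cases
    case 1
    then show ?thesis by (intro gate) (auto simp: \<mu>_def cnt_def)
  next
    case 2
    then show ?thesis by (intro start) (auto simp: \<mu>_def cnt_def)
  next
    case (3 n)
    then show ?thesis by (intro state[of n]) (auto simp: \<mu>_def cnt_def)
  next
    case (4 n)
    then show ?thesis by (intro trans[of n]) (auto simp: \<mu>_def cnt_def)
  qed
qed

lemma \<mu>_edge: "run ks \<Longrightarrow> edge (\<mu> ks j) (\<mu> ks (Suc j))"
  by (cases rule: \<mu>_cases[of j ks]) (auto simp: run_def)

text \<open>Up to its first departure from the main play \<open>\<mu> ks\<close>, a consistent play shows the current
  vector in its accumulated weights, and component 1 counts the transitions.\<close>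
definition main_inv :: "(nat \<Rightarrow> nat) \<Rightarrow> (nat \<Rightarrow> nat) \<Rightarrow> nat \<Rightarrow> bool" where
  "main_inv ks \<pi> j \<longleftrightarrow>
     (\<forall>l\<le>j. vdec (\<pi> l) = \<mu> ks l) \<and> acc G \<pi> 0 j = 0 \<and> acc G \<pi> 1 j = int (cnt j)
       \<and> (\<forall>i\<in>{2..t}. acc G \<pi> i j = (if j < t then 0 else 2 * vec ks (cnt j) i))
   \<or> vdec (\<pi> j) = Quit 0 \<and> acc G \<pi> 0 j = 0 \<and> acc G \<pi> 1 j = 0 \<and> (\<forall>i\<in>{2..t}. acc G \<pi> i j = -1)
   \<or> (\<exists>n a. vdec (\<pi> j) \<in> {Chal a, Fin a} \<and> a \<in> chk (ks n) \<and> acc G \<pi> 1 j = int (Suc n)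
       \<and> acc G \<pi> a j = 2 * vec ks (Suc n) a)"

text \<open>At states the play still shows a main history, on which \<open>follow\<close> fixes the
  choice of \<open>\<sigma>0\<close>; hence it can depart only at a gate, by quitting, or after a
  transition, by a challenge. Quitting adds -1 once, and the loop at \<open>Chal a\<close> leaves
  components 1 and \<open>a\<close> untouched.\<close>

lemma main_inv_consistent:
  assumes "run ks" "follow \<sigma>0 ks" "consistent G \<sigma>0 \<pi>"
  shows "main_inv ks \<pi> j"
proof (induction j)
  case 0
  have "\<mu> ks 0 = Gate 2" "cnt 0 = 0" using t by (auto simp: \<mu>_def cnt_def)
  moreover have "is_play G \<pi>" using assms(3) by (simp add: consistent_def)
  ultimately show ?case using t unfolding main_inv_def by (auto simp: play_0 acc_def)
next
  case (Suc j)
  have play: "is_play G \<pi>" using assms(3) by (simp add: consistent_def)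
  have e: "edge (vdec (\<pi> j)) (vdec (\<pi> (Suc j)))" using play_edge[OF play] .
  have a: "acc G \<pi> i (Suc j) = acc G \<pi> i j + wx (vdec (\<pi> j)) (vdec (\<pi> (Suc j))) i" if "i \<le> t" for i
    using acc_G_Suc[OF play that] .
  have r: "ks n < nT" "src (ks (Suc n)) = dst (ks n)" "src (ks 0) = 0" for n
    using assms(1) by (auto simp: run_def)
  from Suc consider
    (main) "\<forall>l\<le>j. vdec (\<pi> l) = \<mu> ks l" "acc G \<pi> 0 j = 0" "acc G \<pi> 1 j = int (cnt j)"
       "\<forall>i\<in>{2..t}. acc G \<pi> i j = (if j < t then 0 else 2 * vec ks (cnt j) i)"
  | (quit) "vdec (\<pi> j) = Quit 0" "acc G \<pi> 0 j = 0" "acc G \<pi> 1 j = 0" "\<forall>i\<in>{2..t}. acc G \<pi> i j = -1"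
  | (chal) n b where "vdec (\<pi> j) \<in> {Chal b, Fin b}" "b \<in> chk (ks n)" "acc G \<pi> 1 j = int (Suc n)"
       "acc G \<pi> b j = 2 * vec ks (Suc n) b"
    unfolding main_inv_def by blast
  then show ?case
  proof cases
    case quit
    then show ?thesis using e a t unfolding main_inv_def by (auto simp: wx_def)
  next
    case chal
    then have "b \<in> {2..t}" using chk[OF r(1)[of n]] by blast
    then have "2 \<le> b" "b \<le> t" by auto
    then show ?thesis using chal e a t unfolding main_inv_def by (fastforce simp: wx_def)
  next
    case main
    have main_Suc: "main_inv ks \<pi> (Suc j)"
      if "vdec (\<pi> (Suc j)) = \<mu> ks (Suc j)" "acc G \<pi> 0 (Suc j) = 0" "acc G \<pi> 1 (Suc j) = int (cnt (Suc j))"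
       "\<forall>i\<in>{2..t}. acc G \<pi> i (Suc j) = (if Suc j < t then 0 else 2 * vec ks (cnt (Suc j)) i)"
      unfolding main_inv_def using that main(1) le_Suc_eq by auto
    show ?thesis
    proof (cases rule: \<mu>_cases[of j ks])
      case gate
      then have *: "vdec (\<pi> j) = Gate (j + 2)" using main(1) by auto
      show ?thesis
      proof (cases "vdec (\<pi> (Suc j)) = Quit 0")
        case True
        then show ?thesis using main gate * a t unfolding main_inv_def by (auto simp: wx_def)
      next
        case False
        then have "vdec (\<pi> (Suc j)) = \<mu> ks (Suc j)"
          using e gate unfolding * by (auto split: if_splits)
        then show ?thesis using main gate * a t False by (intro main_Suc) (auto simp: wx_def)
      qed
    next
      case start
      then have *: "vdec (\<pi> j) = Gate 0" "vdec (\<pi> (Suc j)) = State 0" using main(1) e by auto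
      then show ?thesis using main start a t r by (intro main_Suc) (auto simp: wx_def vec_def)
    next
      case (state n)
      then have *: "vdec (\<pi> j) = State (src (ks n))" using main(1) by auto
      then have "\<pi> (Suc j) = \<sigma>0 (map \<pi> [0..<Suc j])"
        using assms(3) owner_0_iff[OF play_bound[OF play]] unfolding consistent_def by blast
      moreover have "map \<pi> [0..<Suc j] = map (venc \<circ> \<mu> ks) [0..<Suc (t + 2 * n)]"
        using main(1) state(1) by (auto simp: vdec_eq_iff simp del: upt_Suc)
      ultimately have "vdec (\<pi> (Suc j)) = Trans (ks n)"
        using assms(2) unfolding follow_def by (simp del: upt_Suc venc.simps)
      then show ?thesis using main state * a t by (intro main_Suc) (auto simp: wx_def vec_def)
    next
      case (trans n)
      then have *: "vdec (\<pi> j) = Trans (ks n)" using main(1) by auto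
      with e r(1) consider "vdec (\<pi> (Suc j)) = State (dst (ks n))"
        | b where "b \<in> chk (ks n)" "vdec (\<pi> (Suc j)) = Chal b" by auto
      then show ?thesis
      proof cases
        case 1
        then show ?thesis using main trans * a t r(2) by (intro main_Suc) (auto simp: wx_def)
      next
        case (2 b)
        then have "b \<in> {2..t}" using chk[OF r(1)[of n]] by blast
        then have "2 \<le> b" "b \<le> t" by auto
        then have "acc G \<pi> b (Suc j) = 2 * vec ks (Suc n) b" "acc G \<pi> 1 (Suc j) = int (Suc n)"
          using main trans * a t 2 by (auto simp: wx_def)
        then show ?thesis using 2 unfolding main_inv_def by blast
      qed
    qed
  qed
qed

section \<open>Absorbing vertices, targets and costs\<close>

lemma absorb:
  assumes "is_play G \<pi>" "vdec (\<pi> m) = x" "\<And>y. edge x y \<Longrightarrow> y = x" "m \<le> j"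
  shows "vdec (\<pi> j) = x"
  using assms(4) by (induction j rule: dec_induct) (use assms(2,3) play_edge[OF assms(1)] in metis)+

lemma absorb_unique:
  assumes "is_play G \<pi>" "vdec (\<pi> m) = x" "\<And>y. edge x y \<Longrightarrow> y = x"
    "vdec (\<pi> m') = x'" "\<And>y. edge x' y \<Longrightarrow> y = x'"
  shows "x = x'"
  using absorb[OF assms(1-3), of "max m m'"] absorb[OF assms(1,4,5), of "max m m'"] by simp

lemma mem_T:
  assumes "is_play G \<pi>" "i \<le> t"
  shows "\<pi> j \<in> T G i \<longleftrightarrow> (if i = 0 then vdec (\<pi> j) = Quit 0
    else if i = 1 then (if ne then vdec (\<pi> j) = Gate 2 else vdec (\<pi> j) = Quit 0 \<or> (\<exists>a. vdec (\<pi> j) = Fin a))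
    else vdec (\<pi> j) = Quit 0 \<or> (if ne then \<exists>a. vdec (\<pi> j) = Fin a else vdec (\<pi> j) = Fin i))"
proof -
  have T: "T G i = set (tgt i)" using assms(2) by (simp add: T_def G_def nth_append)
  have ends: "\<pi> j \<in> set ends \<longleftrightarrow> vdec (\<pi> j) = Quit 0 \<or> (\<exists>a. vdec (\<pi> j) = Fin a)"
  proof -
    have "vidx (vdec (\<pi> j)) < B" using play_bound[OF assms(1), of j] venc_less[of "vdec (\<pi> j)"] by simp
    then show ?thesis by (auto simp: ends_def vdec_eq_iff image_iff simp del: venc.simps)
  qed
  show ?thesis unfolding T tgt_def by (auto simp: ends vdec_eq_iff simp del: venc.simps)
qed

lemma mem_T_po:
  assumes "is_play G \<pi>" "\<not> ne"
  shows "\<pi> j \<in> T G 1 \<longleftrightarrow> vdec (\<pi> j) = Quit 0 \<or> (\<exists>a. vdec (\<pi> j) = Fin a)"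
    and "i \<in> {2..t} \<Longrightarrow> \<pi> j \<in> T G i \<longleftrightarrow> vdec (\<pi> j) = Quit 0 \<or> vdec (\<pi> j) = Fin i"
proof -
  have "1 \<le> t" using t by simp
  show "\<pi> j \<in> T G 1 \<longleftrightarrow> vdec (\<pi> j) = Quit 0 \<or> (\<exists>a. vdec (\<pi> j) = Fin a)"
    unfolding mem_T[OF assms(1) \<open>1 \<le> t\<close>] using assms(2) by simp
  show "\<pi> j \<in> T G i \<longleftrightarrow> vdec (\<pi> j) = Quit 0 \<or> vdec (\<pi> j) = Fin i" if "i \<in> {2..t}"
  proof -
    have "i \<le> t" using that by simp
    then show ?thesis unfolding mem_T[OF assms(1) \<open>i \<le> t\<close>] using assms(2) that by simp
  qed
qed

lemma edge_Quit: "edge (Quit a) y \<Longrightarrow> y = Quit a" and edge_Fin: "edge (Fin a) y \<Longrightarrow> y = Fin a"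
  by simp_all

text \<open>Ends are absorbing, so a play meets only one of them. Its first visit to that end is
  therefore the moment at which the costs are read.\<close>

lemma first_end:
  assumes "is_play G \<pi>" "vdec (\<pi> m) = x" "x = Quit 0 \<or> (\<exists>a. x = Fin a)"
  obtains m0 where "vdec (\<pi> m0) = x" "\<And>j. j < m0 \<Longrightarrow> vdec (\<pi> j) \<noteq> Quit 0"
    "\<And>j a. j < m0 \<Longrightarrow> vdec (\<pi> j) \<noteq> Fin a"
proof
  let ?m = "LEAST m. vdec (\<pi> m) = x"
  show "vdec (\<pi> ?m) = x" using assms(2) by (rule LeastI)
  have less: "vdec (\<pi> j) \<noteq> x" if "j < ?m" for j using that by (rule not_less_Least)
  have x: "\<And>y. edge x y \<Longrightarrow> y = x" using assms(3) by auto
  show "vdec (\<pi> j) \<noteq> Quit 0" if "j < ?m" for j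
    using less[OF that] absorb_unique[OF assms(1,2) x _ edge_Quit] by blast
  show "vdec (\<pi> j) \<noteq> Fin a" if "j < ?m" for j a
    using less[OF that] absorb_unique[OF assms(1,2) x _ edge_Fin] by blast
qed

lemma \<mu>_kind: "\<mu> ks j \<noteq> Quit a" "\<mu> ks j \<noteq> Chal a" "\<mu> ks j \<noteq> Fin a"
  by (auto simp: \<mu>_def)

text \<open>The gates precede the start edge and passing them is free, so it does not matter at
  which gate a player quits.\<close>

lemma quit_cost:
  assumes "run ks" "follow \<sigma>0 ks" "consistent G \<sigma>0 \<pi>" "vdec (\<pi> m) = Quit 0"
  shows "cost G 0 \<pi> = 0" "i \<in> {2..t} \<Longrightarrow> cost G i \<pi> = -1" "\<not> ne \<Longrightarrow> cost G 1 \<pi> = 0"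
proof -
  have play: "is_play G \<pi>" using assms(3) by (simp add: consistent_def)
  obtain m0 where m0: "vdec (\<pi> m0) = Quit 0" "\<And>j. j < m0 \<Longrightarrow> vdec (\<pi> j) \<noteq> Quit 0"
    "\<And>j a. j < m0 \<Longrightarrow> vdec (\<pi> j) \<noteq> Fin a"
    using first_end[OF play assms(4)] by blast
  have c: "cost G i \<pi> = ereal (of_int (acc G \<pi> i m0))" if "i \<le> t" "i = 1 \<longrightarrow> \<not> ne" for i
    by (rule cost_first) (use that m0 in \<open>auto simp: mem_T[OF play]\<close>)
  have "main_inv ks \<pi> m0" by (rule main_inv_consistent[OF assms(1-3)])
  then have a: "acc G \<pi> 0 m0 = 0" "acc G \<pi> 1 m0 = 0" "\<forall>i\<in>{2..t}. acc G \<pi> i m0 = -1"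
    using m0(1) \<mu>_kind unfolding main_inv_def by auto
  show "cost G 0 \<pi> = 0" using c[of 0] a by simp
  show "cost G i \<pi> = -1" if "i \<in> {2..t}" using c[of i] a that by (auto simp: one_ereal_def)
  show "cost G 1 \<pi> = 0" if "\<not> ne" using c[of 1] a t that by simp
qed

text \<open>Only component \<open>a\<close> and, in the Pareto setting, the number of transitions
  are determined: the loop at \<open>Chal a\<close> may have lowered the others arbitrarily.\<close>

lemma fin_cost:
  assumes "run ks" "follow \<sigma>0 ks" "consistent G \<sigma>0 \<pi>" "vdec (\<pi> m) = Fin a"
  obtains n where "a \<in> chk (ks n)" "a \<in> {2..t}" "cost G a \<pi> = ereal (of_int (2 * vec ks (Suc n) a))"
    "\<not> ne \<Longrightarrow> cost G 1 \<pi> = ereal (of_int (int (Suc n)))"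
proof -
  have play: "is_play G \<pi>" using assms(3) by (simp add: consistent_def)
  obtain m0 where m0: "vdec (\<pi> m0) = Fin a" "\<And>j. j < m0 \<Longrightarrow> vdec (\<pi> j) \<noteq> Quit 0"
    "\<And>j a. j < m0 \<Longrightarrow> vdec (\<pi> j) \<noteq> Fin a"
    using first_end[OF play assms(4)] by blast
  have "main_inv ks \<pi> m0" by (rule main_inv_consistent[OF assms(1-3)])
  then obtain n where n: "a \<in> chk (ks n)" "acc G \<pi> 1 m0 = int (Suc n)"
      "acc G \<pi> a m0 = 2 * vec ks (Suc n) a"
    using m0(1) \<mu>_kind unfolding main_inv_def by auto
  have "ks n < nT" using assms(1) by (simp add: run_def)
  then have a: "a \<in> {2..t}" using n(1) chk by blast
  have "cost G a \<pi> = ereal (of_int (2 * vec ks (Suc n) a))"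
    unfolding n(3)[symmetric]
    by (rule cost_first) (use a m0 in \<open>auto simp: mem_T[OF play]\<close>)
  moreover have "cost G 1 \<pi> = ereal (of_int (int (Suc n)))" if "\<not> ne"
    unfolding n(2)[symmetric]
    by (rule cost_first) (use m0 in \<open>auto simp: mem_T_po(1)[OF play that] simp del: One_nat_def\<close>)
  ultimately show ?thesis by (rule that[OF n(1) a])
qed

lemma unended_cost:
  assumes "is_play G \<pi>" "\<And>m. vdec (\<pi> m) \<noteq> Quit 0" "\<And>m a. vdec (\<pi> m) \<noteq> Fin a" "i \<in> {2..t}"
  shows "cost G i \<pi> = \<infinity>"
  by (rule cost_infinite) (use assms in \<open>auto simp: mem_T[OF assms(1)]\<close>)

lemma unquit_gates:
  assumes "is_play G \<pi>" "\<And>m. vdec (\<pi> m) \<noteq> Quit 0" "Suc j < t"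
  shows "vdec (\<pi> j) = Gate (j + 2)"
  using assms(3)
proof (induction j)
  case 0
  then show ?case using play_0[OF assms(1)] by simp
next
  case (Suc j)
  then have "vdec (\<pi> j) = Gate (j + 2)" by simp
  then show ?case using play_edge[OF assms(1), of j] assms(2)[of "Suc j"] Suc.prems by (auto split: if_splits)
qed

section \<open>Runs and strategies of player 0\<close>

lemma run_edge:
  assumes "run ks"
  shows "(venc (State (src (ks n))), venc (Trans (ks n))) \<in> E G"
proof -
  have "ks n < nT" using assms by (simp add: run_def)
  then show ?thesis using bounds nT by (auto simp: E_G venc_less simp del: venc.simps)
qed

text \<open>The strategy reads the step number off the length of the history. Off the main play the
  prescribed transition may be illegal, and then any successor is taken.\<close>

lemma strategy_of_run:
  assumes "run ks"
  shows "\<exists>\<sigma>0. is_strategy G 0 \<sigma>0 \<and> follow \<sigma>0 ks"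
proof (intro exI conjI)
  let ?v = "\<lambda>h. venc (Trans (ks ((length h - 1 - t) div 2)))"
  let ?\<sigma> = "\<lambda>h. if (last h, ?v h) \<in> E G then ?v h else SOME v. (last h, v) \<in> E G"
  show "is_strategy G 0 ?\<sigma>"
    unfolding is_strategy_def using some_successor[OF wf_base_G] by auto
  show "follow ?\<sigma> ks"
    unfolding follow_def
  proof
    fix n
    have "\<mu> ks (t + 2 * n) = State (src (ks n))" by (simp add: \<mu>_def)
    then show "?\<sigma> (map (venc \<circ> \<mu> ks) [0..<Suc (t + 2 * n)]) = venc (Trans (ks n))"
      using run_edge[OF assms, of n] by simp
  qed
qed

lemma run_of_strategy:
  assumes "is_strategy G 0 \<sigma>0"
  shows "\<exists>ks. run ks \<and> follow \<sigma>0 ks"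
proof -
  obtain k0 where k0: "src k0 = 0" using total(1) by blast
  define tr where "tr h = vidx (vdec (\<sigma>0 h))" for h
  \<comment> \<open>\<open>H n\<close> is the main history before transition \<open>n\<close>,
    extended by asking \<open>\<sigma>0\<close> and moving on to the next state. The first
    \<open>t + 1\<close> vertices depend on the run only through its initial state 0, so any
    \<open>k0\<close> leaving state 0 can stand in.\<close>
  define H where "H = rec_nat (map (venc \<circ> \<mu> (\<lambda>_. k0)) [0..<Suc t])
    (\<lambda>_ h. h @ [\<sigma>0 h, venc (State (dst (tr h)))])"
  have H0: "H 0 = map (venc \<circ> \<mu> (\<lambda>_. k0)) [0..<Suc t]"
    and HS: "H (Suc n) = H n @ [\<sigma>0 (H n), venc (State (dst (tr (H n))))]" for n
    by (simp_all add: H_def)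
  define ks where "ks n = tr (H n)" for n
  define pc where "pc n = (case n of 0 \<Rightarrow> 0 | Suc m \<Rightarrow> dst (ks m))" for n
  have snoc: "is_history G (h @ [v])" if "is_history G h" "(last h, v) \<in> E G" for h v
    using that unfolding is_history_def
    by (auto simp: nth_append last_conv_nth less_Suc_eq) (metis One_nat_def diff_Suc_1)
  have step: "\<sigma>0 (H n) = venc (Trans (ks n)) \<and> ks n < nT \<and> src (ks n) = pc n"
    if prem: "is_history G (H n)" "last (H n) = venc (State (pc n))" "\<exists>k<nT. src k = pc n" for n
  proof -
    have "last (H n) < 6 * B" using history_last_less[OF wf_base_G that(1)] by (simp add: G_def)
    then have "owner G (last (H n)) = 0" using that(2) owner_0_iff by (metis vdec_venc)
    then have "(last (H n), \<sigma>0 (H n)) \<in> E G" using assms that(1) unfolding is_strategy_def by blast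
    then have "edge (State (pc n)) (vdec (\<sigma>0 (H n)))" using that(2) by (metis E_G vdec_venc)
    then obtain k where "k < nT" "src k = pc n" "vdec (\<sigma>0 (H n)) = Trans k" using prem(3) by auto
    then show ?thesis unfolding ks_def tr_def by (metis venc_vdec vidx.simps(3))
  qed
  have main: "is_history G (H n) \<and> last (H n) = venc (State (pc n)) \<and> (\<exists>k<nT. src k = pc n)" for n
  proof (induction n)
    case 0
    have "edge (\<mu> (\<lambda>_. k0) j) (\<mu> (\<lambda>_. k0) (Suc j))" if "j < t" for j
      using that k0 by (cases rule: \<mu>_cases[of j "\<lambda>_. k0"]) auto
    moreover have "vidx (\<mu> (\<lambda>_. k0) j) < B" if "j \<le> t" for j
      using that t k0 by (auto simp: \<mu>_def)
    ultimately have "((venc \<circ> \<mu> (\<lambda>_. k0)) j, (venc \<circ> \<mu> (\<lambda>_. k0)) (Suc j)) \<in> E G" if "j < t" for j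
      using that by (simp add: E_G venc_less del: venc.simps)
    then have "is_history G (H 0)"
      unfolding H0 using t by (intro is_history_map) (auto simp: G_simps \<mu>_def)
    moreover have "last (H 0) = venc (State (pc 0))"
      unfolding H0 pc_def using k0 by (simp add: \<mu>_def)
    ultimately show ?case using total(1) by (simp add: pc_def)
  next
    case (Suc n)
    have s: "\<sigma>0 (H n) = venc (Trans (ks n))" "ks n < nT" "src (ks n) = pc n"
      using step Suc by blast+
    have pc: "pc (Suc n) = dst (ks n)" by (simp add: pc_def)
    have b: "pc n < B" "dst (ks n) < B" "ks n < B" using bounds[OF s(2)] s(2,3) nT by auto
    have "(last (H n), \<sigma>0 (H n)) \<in> E G"
      using Suc s b by (auto simp: E_G venc_less simp del: venc.simps)
    moreover have "(\<sigma>0 (H n), venc (State (pc (Suc n)))) \<in> E G"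
      using s b pc by (simp add: E_G venc_less del: venc.simps)
    ultimately have "is_history G ((H n @ [\<sigma>0 (H n)]) @ [venc (State (pc (Suc n)))])"
      using Suc by (intro snoc) auto
    then have "is_history G (H (Suc n))" unfolding HS pc ks_def by simp
    then show ?case using total(2)[OF s(2)] pc by (simp add: HS ks_def del: venc.simps)
  qed
  have s: "\<sigma>0 (H n) = venc (Trans (ks n))" "ks n < nT" "src (ks n) = pc n" for n
    using step main by blast+
  have run: "run ks" unfolding run_def using s(2,3) by (simp add: pc_def)
  have "H n = map (venc \<circ> \<mu> ks) [0..<Suc (t + 2 * n)]" for n
  proof (induction n)
    case 0
    have "\<mu> ks j = \<mu> (\<lambda>_. k0) j" if "j \<le> t" for j
      using that s(3)[of 0] k0 by (auto simp: \<mu>_def pc_def)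
    then show ?case unfolding H0 by (auto simp del: upt_Suc)
  next
    case (Suc n)
    have "\<mu> ks (Suc (t + 2 * n)) = Trans (ks n)" "\<mu> ks (Suc (Suc (t + 2 * n))) = State (src (ks (Suc n)))"
      by (auto simp: \<mu>_def)
    moreover have "H (Suc n) = H n @ [venc (Trans (ks n)), venc (State (src (ks (Suc n))))]"
      using s(3)[of "Suc n"] by (simp add: HS s(1) pc_def ks_def del: venc.simps)
    moreover have "map (venc \<circ> \<mu> ks) [0..<Suc (t + 2 * Suc n)]
      = map (venc \<circ> \<mu> ks) [0..<Suc (t + 2 * n)] @ [venc (\<mu> ks (Suc (t + 2 * n))), venc (\<mu> ks (Suc (Suc (t + 2 * n))))]"
      by simp
    ultimately show ?case using Suc by (simp only:)
  qed
  then have "follow \<sigma>0 ks" unfolding follow_def using s(1) by metis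
  with run show ?thesis by blast
qed

section \<open>Plays that challenge a transition\<close>

text \<open>The main play through transition \<open>n\<close>, then \<open>M\<close> passes of the
  loop at \<open>Chal i\<close>, then \<open>Fin i\<close>.\<close>

definition challenge_play :: "(nat \<Rightarrow> nat) \<Rightarrow> nat \<Rightarrow> nat \<Rightarrow> nat \<Rightarrow> nat \<Rightarrow> nat" where
  "challenge_play ks n i M j = venc (if j \<le> t + 2 * n + 1 then \<mu> ks j
     else if j \<le> t + 2 * n + 2 + M then Chal i else Fin i)"

context
  fixes \<sigma>0 :: "nat list \<Rightarrow> nat" and ks :: "nat \<Rightarrow> nat" and n i :: nat
  assumes run: "run ks" and follow: "follow \<sigma>0 ks" and i: "i \<in> chk (ks n)"
begin

lemma i_range: "i \<in> {2..t}"
  using chk[of "ks n"] run i unfolding run_def by blast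

lemma challenge_play_consistent: "consistent G \<sigma>0 (challenge_play ks n i M)"
proof -
  let ?\<beta> = "challenge_play ks n i M"
  have kn: "ks n < nT" using run by (simp add: run_def)
  have \<mu>n: "\<mu> ks (t + 2 * n + 1) = Trans (ks n)" by (simp add: \<mu>_def)
  have e: "edge (vdec (?\<beta> j)) (vdec (?\<beta> (Suc j)))" for j
  proof -
    consider "Suc j \<le> t + 2 * n + 1" | "j = t + 2 * n + 1" | "j > t + 2 * n + 1" by linarith
    then show ?thesis
    proof cases
      case 1
      then show ?thesis using \<mu>_edge[OF run, of j] by (simp add: challenge_play_def)
    next
      case 2
      then show ?thesis using \<mu>n kn i by (simp add: challenge_play_def del: venc.simps)
    next
      case 3
      then show ?thesis by (auto simp: challenge_play_def)
    qed
  qed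
  have 0: "?\<beta> 0 = venc (Gate 2)" using t by (simp add: challenge_play_def \<mu>_def)
  have b: "vidx (vdec (?\<beta> j)) < B" for j
  proof (induction j)
    case 0
    then show ?case using t \<open>?\<beta> 0 = venc (Gate 2)\<close> by (simp del: venc.simps)
  next
    case (Suc j)
    then show ?case using edge_bounded[OF e] by blast
  qed
  then have b': "?\<beta> j < 6 * B" for j using venc_less[of "vdec (?\<beta> j)"] by simp
  have play: "is_play G ?\<beta>"
    unfolding is_play_def using 0 b' e by (simp add: E_G G_simps)
  have "?\<beta> (Suc j) = \<sigma>0 (map ?\<beta> [0..<Suc j])" if owner: "owner G (?\<beta> j) = 0" for j
  proof -
    obtain p where p: "vdec (?\<beta> j) = State p" using owner owner_0_iff[OF b'] by blast
    then have j: "j \<le> t + 2 * n + 1" "\<mu> ks j = State p"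
      unfolding challenge_play_def by (auto split: if_splits simp del: venc.simps)
    then obtain m where m: "j = t + 2 * m" "\<mu> ks (Suc j) = Trans (ks m)"
      by (cases rule: \<mu>_cases[of j ks]) auto
    then have "?\<beta> (Suc j) = venc (Trans (ks m))" using j by (simp add: challenge_play_def)
    moreover have "map ?\<beta> [0..<Suc j] = map (venc \<circ> \<mu> ks) [0..<Suc (t + 2 * m)]"
      using m j by (auto simp: challenge_play_def simp del: upt_Suc)
    ultimately show ?thesis using follow unfolding follow_def by metis
  qed
  then show ?thesis unfolding consistent_def using play by blast
qed

lemma challenge_play_acc:
  assumes "l \<le> M" "p \<in> {1..t}"
  shows "acc G (challenge_play ks n i M) p (t + 2 * n + 2 + l) =
    (if p = 1 then int (Suc n) else 2 * vec ks (Suc n) p - (if p = i then 0 else int l))"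
  using assms(1)
proof (induction l)
  case 0
  let ?\<beta> = "challenge_play ks n i M" and ?a = "t + 2 * n + 1"
  have play: "is_play G ?\<beta>" using challenge_play_consistent by (simp add: consistent_def)
  have \<mu>n: "\<mu> ks ?a = Trans (ks n)" by (simp add: \<mu>_def)
  have "main_inv ks ?\<beta> ?a" by (rule main_inv_consistent[OF run follow challenge_play_consistent])
  moreover have "vdec (?\<beta> ?a) = Trans (ks n)" using \<mu>n by (simp add: challenge_play_def del: venc.simps)
  moreover have "cnt ?a = Suc n" by (simp add: cnt_def)
  ultimately have "acc G ?\<beta> 1 ?a = int (Suc n)" "\<forall>i\<in>{2..t}. acc G ?\<beta> i ?a = 2 * vec ks (Suc n) i"
    unfolding main_inv_def by auto
  moreover have "acc G ?\<beta> p (Suc ?a) = acc G ?\<beta> p ?a"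
    using acc_G_Suc[OF play, of p ?a] assms(2) \<mu>n by (simp add: challenge_play_def wx_def del: venc.simps)
  ultimately show ?case using assms(2) by (auto simp: numeral_2_eq_2)
next
  case (Suc l)
  let ?\<beta> = "challenge_play ks n i M" and ?a = "t + 2 * n + 2 + l"
  have play: "is_play G ?\<beta>" using challenge_play_consistent by (simp add: consistent_def)
  have "acc G ?\<beta> p (Suc ?a) = acc G ?\<beta> p ?a + (if 2 \<le> p \<and> p \<noteq> i then -1 else 0)"
    using acc_G_Suc[OF play, of p ?a] assms(2) Suc.prems by (simp add: challenge_play_def wx_def del: venc.simps)
  then show ?case using Suc assms(2) by auto
qed

lemma challenge_play_acc_Fin:
  assumes "p \<in> {1..t}"
  shows "acc G (challenge_play ks n i M) p (t + 2 * n + 3 + M) =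
    (if p = 1 then int (Suc n) else 2 * vec ks (Suc n) p - (if p = i then 0 else int M))"
proof -
  let ?\<beta> = "challenge_play ks n i M" and ?a = "t + 2 * n + 2 + M"
  have play: "is_play G ?\<beta>" using challenge_play_consistent by (simp add: consistent_def)
  have "acc G ?\<beta> p (Suc ?a) = acc G ?\<beta> p ?a"
    using acc_G_Suc[OF play, of p ?a] assms by (simp add: challenge_play_def wx_def del: venc.simps)
  then show ?thesis using challenge_play_acc[of M M p] assms by (simp add: numeral_3_eq_3)
qed

lemma vdec_challenge_play: "vdec (challenge_play ks n i M j) = (if j \<le> t + 2 * n + 1 then \<mu> ks j
     else if j \<le> t + 2 * n + 2 + M then Chal i else Fin i)"
  by (simp add: challenge_play_def del: venc.simps)

lemma challenge_play_cost_0: "cost G 0 (challenge_play ks n i M) = \<infinity>"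
  by (rule cost_infinite)
    (use challenge_play_consistent \<mu>_kind in \<open>auto simp: consistent_def mem_T vdec_challenge_play\<close>)

text \<open>The second assumption selects the components that meet their target first at
  \<open>Fin i\<close>.\<close>

lemma challenge_play_cost_Fin:
  assumes "p \<in> {1..t}" "if ne then p \<noteq> 1 else p \<in> {1, i}"
  shows "cost G p (challenge_play ks n i M) = ereal (of_int
    (if p = 1 then int (Suc n) else 2 * vec ks (Suc n) p - (if p = i then 0 else int M)))"
  unfolding challenge_play_acc_Fin[OF assms(1), of M, symmetric]
  by (rule cost_first)
    (use challenge_play_consistent[of M] \<mu>_kind assms in \<open>auto simp: consistent_def mem_T vdec_challenge_play split: if_splits\<close>)

lemma challenge_play_cost_other:
  assumes "\<not> ne" "p \<in> {2..t}" "p \<noteq> i"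
  shows "cost G p (challenge_play ks n i M) = \<infinity>"
  by (rule cost_infinite)
    (use challenge_play_consistent[of M] \<mu>_kind assms(2,3) in
      \<open>auto simp: consistent_def mem_T_po(2)[OF _ assms(1)] vdec_challenge_play\<close>)

end

section \<open>An honest run lets player 0 win\<close>

text \<open>Some player has reason to regret not quitting: if the play ends at a challenge, the
  challenged component is nonnegative by honesty; if it never ends, component 2 is infinite.\<close>

lemma honest_cost:
  assumes "run ks" "honest ks" "follow \<sigma>0 ks" "consistent G \<sigma>0 \<pi>" "\<And>m. vdec (\<pi> m) \<noteq> Quit 0"
  shows "\<exists>b\<in>{2..t}. 0 \<le> cost G b \<pi>"
proof (cases "\<exists>m a. vdec (\<pi> m) = Fin a")
  case True
  then obtain m a where "vdec (\<pi> m) = Fin a" by blast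
  then obtain n where n: "a \<in> chk (ks n)" "a \<in> {2..t}" "cost G a \<pi> = ereal (of_int (2 * vec ks (Suc n) a))"
    using fin_cost[OF assms(1,3,4)] by metis
  then have "0 \<le> cost G a \<pi>" using assms(2) unfolding honest_def by simp
  then show ?thesis using n(2) by blast
next
  case False
  have "is_play G \<pi>" using assms(4) by (simp add: consistent_def)
  then have "cost G 2 \<pi> = \<infinity>" using unended_cost[of \<pi> 2] assms(5) False t by auto
  then show ?thesis using t by (intro bexI[of _ 2]) auto
qed

lemma NCNS_if_honest:
  assumes ne: "ne" and "run ks" "honest ks"
  shows "NCNS G"
proof -
  obtain \<sigma>0 where \<sigma>0: "is_strategy G 0 \<sigma>0" "follow \<sigma>0 ks" using strategy_of_run[OF assms(2)] by blast
  have "cost G 0 (out G \<sigma>) \<le> ereal (real (bound G))" if NE: "fixed_NE G \<sigma>0 \<sigma>" for \<sigma>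
  proof (rule ccontr)
    assume bad: "\<not> cost G 0 (out G \<sigma>) \<le> ereal (real (bound G))"
    have prof: "is_profile G \<sigma>" "\<sigma> 0 = \<sigma>0" using NE by (auto simp: fixed_NE_def)
    have con: "consistent G \<sigma>0 (out G \<sigma>)" using out_consistent[OF wf_ne_G[OF ne] prof(1)] prof(2) by simp
    have unquit: "vdec (out G \<sigma> m) \<noteq> Quit 0" for m
      using quit_cost(1)[OF assms(2) \<sigma>0(2) con] bad by (auto simp: G_simps)
    obtain b where b: "b \<in> {2..t}" "0 \<le> cost G b (out G \<sigma>)"
      using honest_cost[OF assms(2,3) \<sigma>0(2) con unquit] by blast
    \<comment> \<open>Player \<open>b\<close> quits at the own gate. The deviating play need not be
      compared with the original one: if somebody else quits earlier, the cost is -1 as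
      well.\<close>
    define \<tau> where "\<tau> h = (if last h = venc (Gate b) then venc (Quit 0) else \<sigma> b h)" for h
    have bt: "b \<le> tpl G" using b by (simp add: G_simps)
    have "(venc (Gate b), venc (Quit 0)) \<in> E G"
      using b(1) t by (auto simp: E_G venc_less simp del: venc.simps)
    then have \<tau>: "is_strategy G b \<tau>"
      using prof(1) bt unfolding is_strategy_def is_profile_def \<tau>_def by simp
    let ?\<sigma> = "\<sigma>(b := \<tau>)"
    have "is_profile G ?\<sigma>" using prof(1) \<tau> unfolding is_profile_def by simp
    moreover have "?\<sigma> 0 = \<sigma>0" using b prof(2) by simp
    ultimately have con': "consistent G \<sigma>0 (out G ?\<sigma>)"
      using out_consistent[OF wf_ne_G[OF ne], of ?\<sigma>] by simp
    then have play': "is_play G (out G ?\<sigma>)" by (simp add: consistent_def)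
    have "\<exists>m. vdec (out G ?\<sigma> m) = Quit 0"
    proof (rule ccontr)
      assume "\<not> ?thesis"
      then have "vdec (out G ?\<sigma> (b - 2)) = Gate (b - 2 + 2)"
        using unquit_gates[OF play', of "b - 2"] b(1) t by auto
      then have g: "vdec (out G ?\<sigma> (b - 2)) = Gate b"
        using b(1) by (metis atLeastAtMost_iff le_add_diff_inverse2)
      have "own (out G ?\<sigma> (b - 2)) = b" unfolding own_def g using b(1) ne by simp
      then have "owner G (out G ?\<sigma> (b - 2)) = b"
        using owner_G[OF play_bound[OF play']] by metis
      then have "out G ?\<sigma> (Suc (b - 2)) = \<tau> (map (out G ?\<sigma>) [0..<Suc (b - 2)])"
        using out_Suc[of G ?\<sigma> "b - 2"] by simp
      also have "\<dots> = venc (Quit 0)" using g by (simp add: \<tau>_def vdec_eq_iff)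
      finally have "vdec (out G ?\<sigma> (Suc (b - 2))) = Quit 0" by (simp del: venc.simps)
      with \<open>\<not> ?thesis\<close> show False by blast
    qed
    then have "cost G b (out G ?\<sigma>) = -1" using quit_cost(2)[OF assms(2) \<sigma>0(2) con' _ b(1)] by blast
    then have "cost G b (out G ?\<sigma>) < cost G b (out G \<sigma>)" using b(2) by (cases "cost G b (out G \<sigma>)") (auto simp: one_ereal_def)
    moreover have "b \<in> {1..tpl G}" using b by (auto simp: G_simps)
    ultimately show False using NE \<tau> unfolding fixed_NE_def by blast
  qed
  then show ?thesis unfolding NCNS_def using \<sigma>0(1) by blast
qed

lemma NCPS_if_honest:
  assumes ne: "\<not> ne" and "run ks" "honest ks"
  shows "NCPS G"
proof -
  obtain \<sigma>0 where \<sigma>0: "is_strategy G 0 \<sigma>0" "follow \<sigma>0 ks" using strategy_of_run[OF assms(2)] by blast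
  \<comment> \<open>\<open>e\<close> quits at the very first gate, where \<open>\<sigma>0\<close>
    has no say. It dominates every play that does not quit.\<close>
  define e where "e j = venc (if j = 0 then Gate 2 else Quit 0)" for j :: nat
  have "edge (vdec (e j)) (vdec (e (Suc j)))" "vidx (vdec (e j)) < B" for j
    using t by (auto simp: e_def simp del: venc.simps)
  then have "is_play G e"
    unfolding is_play_def using t by (simp add: E_G G_simps e_def venc_less del: venc.simps)
  moreover have "owner G (e j) \<noteq> 0" for j
    using owner_0_iff[of "e j"] play_bound[OF calculation, of j] by (auto simp: e_def simp del: venc.simps)
  ultimately have e: "consistent G \<sigma>0 e" unfolding consistent_def by blast
  have "vdec (e 1) = Quit 0" by (simp add: e_def del: venc.simps)
  note ec = quit_cost[OF assms(2) \<sigma>0(2) e this]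
  have "cost G 0 \<pi> \<le> ereal (real (bound G))" if PO: "fixed_PO G \<sigma>0 \<pi>" for \<pi>
  proof (rule ccontr)
    assume bad: "\<not> cost G 0 \<pi> \<le> ereal (real (bound G))"
    have con: "consistent G \<sigma>0 \<pi>" using PO by (simp add: fixed_PO_def)
    then have play: "is_play G \<pi>" by (simp add: consistent_def)
    have unquit: "vdec (\<pi> m) \<noteq> Quit 0" for m
      using quit_cost(1)[OF assms(2) \<sigma>0(2) con] bad by (auto simp: G_simps)
    have less: "cost G b e < cost G b \<pi>" if b: "b \<in> {2..t}" for b
    proof (cases "\<exists>m. vdec (\<pi> m) = Fin b")
      case True
      then obtain m where "vdec (\<pi> m) = Fin b" by blast
      then obtain n where "b \<in> chk (ks n)" "cost G b \<pi> = ereal (of_int (2 * vec ks (Suc n) b))"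
        using fin_cost[OF assms(2) \<sigma>0(2) con] by metis
      moreover have "0 \<le> vec ks (Suc n) b" using assms(3) calculation(1) unfolding honest_def by blast
      then have "(-1 :: real) < of_int (2 * vec ks (Suc n) b)" by linarith
      ultimately show ?thesis using ec(2)[OF b] by (simp add: one_ereal_def)
    next
      case False
      then have "cost G b \<pi> = \<infinity>"
        using unquit by (intro cost_infinite) (auto simp: mem_T_po(2)[OF play ne b])
      then show ?thesis using ec(2)[OF b] by (simp add: one_ereal_def)
    qed
    have "cost G 1 e \<le> cost G 1 \<pi>"
    proof (cases "\<exists>m a. vdec (\<pi> m) = Fin a")
      case True
      then obtain m a where "vdec (\<pi> m) = Fin a" by blast
      then obtain n where "cost G 1 \<pi> = ereal (of_int (int (Suc n)))"
        using fin_cost[OF assms(2) \<sigma>0(2) con] ne by metis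
      then show ?thesis using ec(3)[OF ne] by simp
    next
      case False
      then have "cost G 1 \<pi> = \<infinity>"
        using unquit by (intro cost_infinite) (auto simp: mem_T_po(1)[OF play ne] simp del: One_nat_def)
      then show ?thesis by simp
    qed
    then have "cost G b e \<le> cost G b \<pi>" if "b \<in> {1..t}" for b
      using less[of b] that by (cases "b = 1") auto
    moreover have "cost G 2 e < cost G 2 \<pi>" "2 \<in> {1..t}" using less t by auto
    ultimately have "pareto_less G e \<pi>" unfolding pareto_less_def G_simps by blast
    then show False using PO e unfolding fixed_PO_def by blast
  qed
  then show ?thesis unfolding NCPS_def using \<sigma>0(1) by blast
qed

section \<open>A violated check lets the environment win\<close>

text \<open>Minimality serves the Pareto setting, where an earlier violated check would offer a
  challenge that is smaller in component 1.\<close>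

lemma first_violation:
  assumes "\<not> honest ks"
  obtains n i where "i \<in> chk (ks n)" "vec ks (Suc n) i < 0"
    "\<And>m j. m < n \<Longrightarrow> j \<in> chk (ks m) \<Longrightarrow> 0 \<le> vec ks (Suc m) j"
proof -
  let ?P = "\<lambda>n. \<exists>i\<in>chk (ks n). vec ks (Suc n) i < 0"
  have "\<exists>n. ?P n" using assms unfolding honest_def by (auto simp: not_le)
  then obtain i where i: "i \<in> chk (ks (LEAST n. ?P n))" "vec ks (Suc (LEAST n. ?P n)) i < 0"
    using LeastI_ex[of ?P] by blast
  show ?thesis
  proof (rule that[OF i])
    fix m j
    assume "m < (LEAST n. ?P n)" "j \<in> chk (ks m)"
    then show "0 \<le> vec ks (Suc m) j" using not_less_Least[of m ?P] by (auto simp: not_less)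
  qed
qed

text \<open>If the run of \<open>\<sigma>0\<close> violates a check, the profile following the
  challenge is an equilibrium: player 1 is indifferent, all others already pay at most -1, which is
  what quitting would bring, and they have no other deviation. Player 0 pays infinity.\<close>

lemma honest_if_NCNS:
  assumes ne: "ne" and win: "NCNS G"
  shows "\<exists>ks. run ks \<and> honest ks"
proof -
  obtain \<sigma>0 where \<sigma>0: "is_strategy G 0 \<sigma>0"
    "\<And>\<sigma>. fixed_NE G \<sigma>0 \<sigma> \<Longrightarrow> cost G 0 (out G \<sigma>) \<le> ereal (real (bound G))"
    using win unfolding NCNS_def by blast
  obtain ks where ks: "run ks" "follow \<sigma>0 ks" using run_of_strategy[OF \<sigma>0(1)] by blast
  have "honest ks"
  proof (rule ccontr)
    assume "\<not> honest ks"
    then obtain n i where i: "i \<in> chk (ks n)" "vec ks (Suc n) i < 0" using first_violation by metis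
    \<comment> \<open>So many loops push every component from 2 on other than \<open>i\<close> to at
      most -1; component \<open>i\<close> is at most -2 by the violation.\<close>
    define M where "M = nat (1 + (\<Sum>p\<in>{2..t}. \<bar>2 * vec ks (Suc n) p\<bar>))"
    have M: "2 * vec ks (Suc n) p - int M \<le> -1" if "p \<in> {2..t}" for p
    proof -
      have "\<bar>2 * vec ks (Suc n) p\<bar> \<le> (\<Sum>p\<in>{2..t}. \<bar>2 * vec ks (Suc n) p\<bar>)"
        by (rule member_le_sum) (use that in auto)
      then show ?thesis unfolding M_def by linarith
    qed
    let ?\<beta> = "challenge_play ks n i M" and ?\<sigma> = "follow_play G \<sigma>0 (challenge_play ks n i M)"
    have con: "consistent G \<sigma>0 ?\<beta>" by (rule challenge_play_consistent[OF ks i(1)])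
    have prof: "is_profile G ?\<sigma>" by (rule is_profile_follow_play[OF wf_base_G \<sigma>0(1) con])
    have out: "out G ?\<sigma> = ?\<beta>" by (rule out_follow_play[OF con])
    have \<sigma>_0: "?\<sigma> 0 = \<sigma>0" by (simp add: follow_play_def fun_eq_iff)
    have \<beta>unquit: "vdec (?\<beta> m) \<noteq> Quit 0" for m
      using vdec_challenge_play[OF ks i(1)] \<mu>_kind by simp
    have cost: "cost G p ?\<beta> \<le> -1" if "p \<in> {2..t}" for p
      using challenge_play_cost_Fin[OF ks i(1), of p M] that ne M[OF that] i(2)
      by (auto simp: one_ereal_def split: if_splits)
    have "\<not> cost G p (out G (?\<sigma>(p := \<tau>))) < cost G p (out G ?\<sigma>)"
      if p: "p \<in> {1..tpl G}" "is_strategy G p \<tau>" for p \<tau>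
    proof -
      define \<pi> where "\<pi> = out G (?\<sigma>(p := \<tau>))"
      have "is_profile G (?\<sigma>(p := \<tau>))" using prof p(2) unfolding is_profile_def by simp
      then have con': "consistent G \<sigma>0 \<pi>"
        using out_consistent[OF wf_ne_G[OF ne], of "?\<sigma>(p := \<tau>)"] p(1) \<sigma>_0 by (simp add: \<pi>_def)
      then have play': "is_play G \<pi>" by (simp add: consistent_def)
      have play: "is_play G ?\<beta>" using con by (simp add: consistent_def)
      show ?thesis
      proof (cases "p = 1")
        case True
        \<comment> \<open>The initial vertex is a target of player 1, so the empty sum is the
          cost.\<close>
        have "cost G 1 \<rho> = ereal (of_int (acc G \<rho> 1 0))" if "is_play G \<rho>" for \<rho>
          by (rule cost_first) (use mem_T[OF that, of 1 0] play_0[OF that] t ne in simp_all)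
        then show ?thesis using True play play' out by (simp add: acc_def \<pi>_def)
      next
        case False
        then have pt: "p \<in> {2..t}" using p(1) by (auto simp: G_simps)
        show ?thesis
        proof (cases "\<exists>m. vdec (\<pi> m) = Quit 0")
          case True
          then have "cost G p \<pi> = -1" using quit_cost(2)[OF ks con' _ pt] by blast
          then show ?thesis using cost[OF pt] out by (simp add: \<pi>_def)
        next
          case nq: False
          \<comment> \<open>If nobody quits, the gate of \<open>p\<close> has a single successor
            left and all other vertices follow \<open>\<beta>\<close>, so the deviation changes
            nothing.\<close>
          have eq: "map \<pi> [0..<Suc k] = map ?\<beta> [0..<Suc k]" for k
          proof (induction k)
            case 0
            then show ?case using play play' by (simp add: is_play_def)
          next
            case (Suc k)
            then have k: "\<pi> k = ?\<beta> k" by simp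
            have "\<pi> (Suc k) = ?\<beta> (Suc k)"
            proof (cases "owner G (\<pi> k) = p")
              case True
              then have "own (\<pi> k) = p" using owner_G[OF play_bound[OF play']] by metis
              then have g: "vdec (\<pi> k) = Gate p" using pt
                unfolding own_def by (auto split: vert.splits if_splits)
              then have "vdec (\<pi> (Suc k)) = (if p = t then Gate 0 else Gate (Suc p))"
                using play_edge[OF play', of k] nq pt by (auto split: if_splits)
              moreover have "vdec (?\<beta> (Suc k)) = (if p = t then Gate 0 else Gate (Suc p))"
                using play_edge[OF play, of k] \<beta>unquit[of "Suc k"] pt g k by (auto split: if_splits)
              ultimately show ?thesis by (metis venc_vdec)
            next
              case False
              then have "\<pi> (Suc k) = ?\<sigma> (owner G (\<pi> k)) (map \<pi> [0..<Suc k])"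
                using out_Suc[of G "?\<sigma>(p := \<tau>)" k] by (simp add: \<pi>_def)
              then show ?thesis using follow_play_prefix[OF con Suc.IH] by simp
            qed
            then show ?case using Suc.IH by simp
          qed
          have "\<pi> k = ?\<beta> k" for k using eq[of k] by simp
          then have "\<pi> = ?\<beta>" by (simp add: fun_eq_iff)
          then show ?thesis using out by (simp add: \<pi>_def)
        qed
      qed
    qed
    then have "fixed_NE G \<sigma>0 ?\<sigma>" unfolding fixed_NE_def using prof \<sigma>_0 by blast
    then show False using \<sigma>0(2) out challenge_play_cost_0[OF ks i(1)] by fastforce
  qed
  then show ?thesis using ks by blast
qed

text \<open>A play dominating the challenge costs at most -2 in component \<open>i\<close>, so it
  cannot quit and must end in \<open>Fin i\<close>. Component 1 forbids a later challenge and
  minimality an earlier one. Then components 1 and \<open>i\<close> agree, and all others are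
  infinite in both plays.\<close>

lemma honest_if_NCPS:
  assumes ne: "\<not> ne" and win: "NCPS G"
  shows "\<exists>ks. run ks \<and> honest ks"
proof -
  obtain \<sigma>0 where \<sigma>0: "is_strategy G 0 \<sigma>0"
    "\<And>\<pi>. fixed_PO G \<sigma>0 \<pi> \<Longrightarrow> cost G 0 \<pi> \<le> ereal (real (bound G))"
    using win unfolding NCPS_def by blast
  obtain ks where ks: "run ks" "follow \<sigma>0 ks" using run_of_strategy[OF \<sigma>0(1)] by blast
  have "honest ks"
  proof (rule ccontr)
    assume "\<not> honest ks"
    then obtain n i where i: "i \<in> chk (ks n)" "vec ks (Suc n) i < 0"
      and least: "\<And>m j. m < n \<Longrightarrow> j \<in> chk (ks m) \<Longrightarrow> 0 \<le> vec ks (Suc m) j"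
      using first_violation by metis
    let ?\<beta> = "challenge_play ks n i 0"
    have con: "consistent G \<sigma>0 ?\<beta>" by (rule challenge_play_consistent[OF ks i(1)])
    have it: "i \<in> {2..t}" by (rule i_range[OF ks i(1)])
    have \<beta>1: "cost G 1 ?\<beta> = ereal (of_int (int (Suc n)))"
      using challenge_play_cost_Fin[OF ks i(1), of 1 0] ne t by simp
    have \<beta>i: "cost G i ?\<beta> = ereal (of_int (2 * vec ks (Suc n) i))"
      using challenge_play_cost_Fin[OF ks i(1), of i 0] ne it by auto
    have \<beta>p: "cost G p ?\<beta> = \<infinity>" if "p \<in> {2..t}" "p \<noteq> i" for p
      by (rule challenge_play_cost_other[OF ks i(1) ne that])
    have "\<not> pareto_less G \<pi> ?\<beta>" if con': "consistent G \<sigma>0 \<pi>" for \<pi>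
    proof
      assume "pareto_less G \<pi> ?\<beta>"
      then have le: "\<And>p. p \<in> {1..t} \<Longrightarrow> cost G p \<pi> \<le> cost G p ?\<beta>"
        and "\<exists>p\<in>{1..t}. cost G p \<pi> < cost G p ?\<beta>"
        unfolding pareto_less_def G_simps by auto
      then obtain p where p: "p \<in> {1..t}" "cost G p \<pi> < cost G p ?\<beta>" by blast
      have play': "is_play G \<pi>" using con' by (simp add: consistent_def)
      have lei: "cost G i \<pi> \<le> ereal (of_int (2 * vec ks (Suc n) i))" using le[of i] \<beta>i it by simp
      have nq: "vdec (\<pi> m) \<noteq> Quit 0" for m
      proof
        assume "vdec (\<pi> m) = Quit 0"
        then have "cost G i \<pi> = -1" by (rule quit_cost(2)[OF ks con' _ it])
        then show False using lei i(2) by (simp add: one_ereal_def)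
      qed
      have "\<exists>m. vdec (\<pi> m) = Fin i"
      proof (rule ccontr)
        assume "\<not> ?thesis"
        then have "cost G i \<pi> = \<infinity>"
          using nq by (intro cost_infinite) (auto simp: mem_T_po(2)[OF play' ne it])
        then show False using lei by simp
      qed
      then obtain m where m: "vdec (\<pi> m) = Fin i" by blast
      obtain n' where n': "i \<in> chk (ks n')" "cost G i \<pi> = ereal (of_int (2 * vec ks (Suc n') i))"
          "cost G 1 \<pi> = ereal (of_int (int (Suc n')))"
        using fin_cost[OF ks con' m] ne by metis
      have "n' \<le> n" using le[of 1] t n'(3) \<beta>1 by simp
      moreover have "\<not> n' < n" using least[OF _ n'(1)] n'(2) lei i(2) by fastforce
      ultimately have "n' = n" by simp
      then have "p \<noteq> 1" "p \<noteq> i" using p(2) n' \<beta>1 \<beta>i by auto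
      then have "p \<in> {2..t}" using p(1) by auto
      have "cost G p \<pi> = \<infinity>"
      proof (rule cost_infinite)
        fix k
        have "vdec (\<pi> k) \<noteq> Fin p"
          using absorb_unique[OF play' m edge_Fin _ edge_Fin] \<open>p \<noteq> i\<close> by blast
        then show "\<pi> k \<notin> T G p" using nq mem_T_po(2)[OF play' ne \<open>p \<in> {2..t}\<close>] by blast
      qed
      then show False using p(2) by simp
    qed
    then have "fixed_PO G \<sigma>0 ?\<beta>" unfolding fixed_PO_def using con by blast
    then show False using \<sigma>0(2) challenge_play_cost_0[OF ks i(1)] by fastforce
  qed
  then show ?thesis using ks by blast
qed

end

section \<open>Loop programs as checked vector machines\<close>

datatype instr = Up nat | Down nat | IsZero nat | Goto

fun csize :: "cmd \<Rightarrow> nat" where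
  "csize Skip = 0"
| "csize (Incr r) = 1"
| "csize (Seq c d) = csize c + csize d"
| "csize (Loop r c) = csize c + 2"

text \<open>A loop head \<open>p\<close> carries both a zero test and a decrement. Player 0 picks
  one of them, and only the checks tell which choice is sound.\<close>

fun code :: "cmd \<Rightarrow> nat \<Rightarrow> (nat \<times> instr \<times> nat) list" where
  "code Skip p = []"
| "code (Incr r) p = [(p, Up r, Suc p)]"
| "code (Seq c d) p = code c p @ code d (p + csize c)"
| "code (Loop r c) p = [(p, IsZero r, p + csize c + 2), (p, Down r, Suc p)] @ code c (Suc p)
     @ [(Suc p + csize c, Goto, p)]"

fun enabled :: "instr \<Rightarrow> (nat \<Rightarrow> nat) \<Rightarrow> bool" where
  "enabled (Down r) s = (0 < s r)"
| "enabled (IsZero r) s = (s r = 0)"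
| "enabled _ s = True"

fun effect :: "instr \<Rightarrow> (nat \<Rightarrow> nat) \<Rightarrow> nat \<Rightarrow> nat" where
  "effect (Up r) s = s(r := Suc (s r))"
| "effect (Down r) s = s(r := s r - 1)"
| "effect _ s = s"

definition step :: "(nat \<times> instr \<times> nat) set \<Rightarrow> nat \<times> (nat \<Rightarrow> nat) \<Rightarrow> nat \<times> (nat \<Rightarrow> nat) \<Rightarrow> bool" where
  "step A x y \<longleftrightarrow> (\<exists>a. (fst x, a, fst y) \<in> A \<and> enabled a (snd x) \<and> snd y = effect a (snd x))"

lemma exec_steps:
  "exec c s s' \<Longrightarrow> set (code c p) \<subseteq> A \<Longrightarrow> (step A)\<^sup>*\<^sup>* (p, s) (p + csize c, s')"
proof (induction arbitrary: p rule: exec.induct)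
  case (exec_Incr r s)
  then have "step A (p, s) (Suc p, s(r := Suc (s r)))"
    unfolding step_def by (intro exI[of _ "Up r"]) auto
  then show ?case by (auto simp del: fun_upd_apply)
next
  case (exec_Seq c s s' c' s'')
  have "(step A)\<^sup>*\<^sup>* (p, s) (p + csize c, s')" using exec_Seq by simp
  also have "(step A)\<^sup>*\<^sup>* (p + csize c, s') (p + csize c + csize c', s'')" using exec_Seq by simp
  finally show ?case by (simp add: add.assoc)
next
  case (exec_Loop0 s r c)
  then have "step A (p, s) (p + csize c + 2, s)"
    unfolding step_def by (intro exI[of _ "IsZero r"]) auto
  then show ?case by auto
next
  case (exec_LoopS s r n c s' s'')
  have "step A (p, s) (Suc p, s(r := n))"
    using exec_LoopS.hyps(1) exec_LoopS.prems unfolding step_def by (intro exI[of _ "Down r"]) auto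
  also have "(step A)\<^sup>*\<^sup>* (Suc p, s(r := n)) (Suc p + csize c, s')"
    by (rule exec_LoopS.IH(1)) (use exec_LoopS.prems in simp)
  also have "step A (Suc p + csize c, s') (p, s')"
    using exec_LoopS.prems unfolding step_def by (intro exI[of _ Goto]) auto
  also have "(step A)\<^sup>*\<^sup>* (p, s') (p + csize (Loop r c), s'')" using exec_LoopS by simp
  finally show ?case .
qed simp

lemma code_range: "(q, a, q') \<in> set (code c p) \<Longrightarrow> p \<le> q \<and> q < p + csize c \<and> q' \<le> p + csize c"
  by (induction c arbitrary: p) fastforce+

lemma code_total: "p \<le> q \<Longrightarrow> q < p + csize c \<Longrightarrow> \<exists>a q'. (q, a, q') \<in> set (code c p)"
proof (induction c arbitrary: p)
  case (Seq c d)
  show ?case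
  proof (cases "q < p + csize c")
    case True
    then show ?thesis using Seq.IH(1)[of p] Seq.prems by auto
  next
    case False
    then show ?thesis using Seq.IH(2)[of "p + csize c"] Seq.prems by auto
  qed
next
  case (Loop r c)
  consider "q = p" | "Suc p \<le> q" "q < Suc p + csize c" | "q = Suc p + csize c"
    using Loop.prems by fastforce
  then show ?case using Loop.IH[of "Suc p"] by cases auto
qed auto

text \<open>Subprograms occupy disjoint ranges, so only a loop head has two instructions, and their
  conditions exclude each other.\<close>

lemma code_deterministic:
  "(q, a, q1) \<in> set (code c p) \<Longrightarrow> (q, b, q2) \<in> set (code c p) \<Longrightarrow> enabled a s \<Longrightarrow> enabled b s
    \<Longrightarrow> a = b \<and> q1 = q2"
proof (induction c arbitrary: p)
  case (Seq c d)
  then show ?case using code_range[of q _ _ c p] code_range[of q _ _ d "p + csize c"] by fastforce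
next
  case (Loop r c)
  then show ?case using code_range[of q _ _ c "Suc p"] by fastforce
qed auto

section \<open>Registers as vector components\<close>

fun checks :: "instr \<Rightarrow> nat set" where
  "checks (Down r) = {2 * r + 2}"
| "checks (IsZero r) = {2 * r + 3}"
| "checks _ = {}"

fun delta :: "instr \<Rightarrow> nat \<Rightarrow> int" where
  "delta (Up r) i = (if i = 2 * r + 2 then 1 else if i = 2 * r + 3 then -1 else 0)"
| "delta (Down r) i = (if i = 2 * r + 2 then -1 else if i = 2 * r + 3 then 1 else 0)"
| "delta _ i = 0"

text \<open>Register \<open>r\<close> is stored twice, as its value in component \<open>2r + 2\<close> and as its negation in
  component \<open>2r + 3\<close>, so that a zero test is also a nonnegativity check.\<close>
definition stores :: "(nat \<Rightarrow> int) \<Rightarrow> (nat \<Rightarrow> nat) \<Rightarrow> bool" where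
  "stores x s \<longleftrightarrow> (\<forall>r. x (2 * r + 2) = int (s r) \<and> x (2 * r + 3) = - int (s r))"

text \<open>Truncated subtraction also gives values to components 0 and 1; the start edge has weight
  0 there.\<close>

definition load :: "(nat \<Rightarrow> nat) \<Rightarrow> nat \<Rightarrow> int" where
  "load s i = (if even i then int (s ((i - 2) div 2)) else - int (s ((i - 3) div 2)))"

lemma stores_load: "stores (load s) s"
  by (auto simp: stores_def load_def)

text \<open>For a register value \<open>v\<close> the checks read \<open>0 \<le> v - 1\<close> for a
  decrement and \<open>0 \<le> - v\<close> for a zero test.\<close>

lemma checks_iff_enabled:
  "stores x s \<Longrightarrow> (\<forall>i\<in>checks a. 0 \<le> x i + delta a i) \<longleftrightarrow> enabled a s"
  by (cases a) (auto simp: stores_def)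

lemma stores_effect:
  assumes "stores x s" "enabled a s"
  shows "stores (\<lambda>i. x i + delta a i) (effect a s)"
proof -
  have "2 * r + 2 \<noteq> 2 * r' + 3" "2 * r + 3 \<noteq> 2 * r' + 2" for r r' :: nat by presburger+
  then show ?thesis using assms unfolding stores_def by (cases a) auto
qed

fun regs :: "cmd \<Rightarrow> nat set" where
  "regs Skip = {}"
| "regs (Incr r) = {r}"
| "regs (Seq c d) = regs c \<union> regs d"
| "regs (Loop r c) = insert r (regs c)"

lemma finite_regs: "finite (regs c)"
  by (induction c) auto

lemma checks_code: "(q, a, q') \<in> set (code c p) \<Longrightarrow> \<forall>r\<in>regs c. r < K \<Longrightarrow> checks a \<subseteq> {2..2 * K + 1}"
  by (induction c arbitrary: p) fastforce+

section \<open>The game of a loop program\<close>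

locale counter_arena =
  fixes c :: cmd and res K B :: nat and ne :: bool and s0 :: "nat \<Rightarrow> nat"
begin

text \<open>After running \<open>c\<close>, the machine loops forever if \<open>res\<close> holds 0 and is stuck otherwise.\<close>
definition prog :: "(nat \<times> instr \<times> nat) list" where
  "prog = code c 0 @ [(csize c, IsZero res, csize c)]"

text \<open>The \<open>K\<close> registers occupy components 2 to \<open>2 * K + 1\<close>, two for
  each.\<close>

sublocale arena "2 * K + 1" "length prog" B "\<lambda>k. fst (prog ! k)" "\<lambda>k. snd (snd (prog ! k))"
  "\<lambda>k. checks (fst (snd (prog ! k)))" "\<lambda>k. delta (fst (snd (prog ! k)))" "load s0" ne .

lemma prog_deterministic:
  "(q, a, q1) \<in> set prog \<Longrightarrow> (q, b, q2) \<in> set prog \<Longrightarrow> enabled a s \<Longrightarrow> enabled b s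
    \<Longrightarrow> a = b \<and> q1 = q2"
  using code_range[of q _ _ c 0] code_deterministic[of q a q1 c 0 b q2 s]
  unfolding prog_def by fastforce

lemma nth_prog: "k < length prog \<Longrightarrow> (fst (prog ! k), fst (snd (prog ! k)), snd (snd (prog ! k))) \<in> set prog"
  by simp

lemma vec_Suc: "vec ks (Suc n) i = vec ks n i + delta (fst (snd (prog ! ks n))) i"
  by (simp add: vec_def)

text \<open>Honesty makes every chosen instruction enabled, and by determinism there is only one
  such instruction, so an honest run has to follow the program.\<close>

lemma run_simulates:
  assumes "run ks" "honest ks" "(step (set prog))\<^sup>*\<^sup>* (0, s0) x"
  shows "\<exists>n. fst (prog ! ks n) = fst x \<and> stores (vec ks n) (snd x)"
  using assms(3)
proof (induction rule: rtranclp_induct)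
  case base
  have "vec ks 0 = load s0" by (simp add: vec_def fun_eq_iff)
  then show ?case using assms(1) stores_load by (intro exI[of _ 0]) (auto simp: run_def)
next
  case (step x y)
  then obtain n where n: "fst (prog ! ks n) = fst x" "stores (vec ks n) (snd x)" by blast
  from step obtain a where a: "(fst x, a, fst y) \<in> set prog" "enabled a (snd x)" "snd y = effect a (snd x)"
    unfolding step_def by blast
  let ?b = "fst (snd (prog ! ks n))"
  have "ks n < length prog" using assms(1) by (simp add: run_def)
  then have b: "(fst x, ?b, snd (snd (prog ! ks n))) \<in> set prog" using nth_prog n(1) by metis
  have "enabled ?b (snd x)"
    using checks_iff_enabled[OF n(2)] assms(2) unfolding honest_def vec_Suc by blast
  then have ab: "a = ?b" "fst y = snd (snd (prog ! ks n))"
    using prog_deterministic[OF a(1) b a(2)] by auto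
  have "fst (prog ! ks (Suc n)) = fst y" using assms(1) ab by (simp add: run_def)
  moreover have "stores (vec ks (Suc n)) (snd y)"
  proof -
    have "vec ks (Suc n) = (\<lambda>i. vec ks n i + delta a i)" using ab by (simp add: fun_eq_iff vec_Suc)
    then show ?thesis using stores_effect[OF n(2) a(2)] a(3) by simp
  qed
  ultimately show ?case by blast
qed

lemma run_of_steps:
  assumes "f 0 = (0, s0)" "\<And>n. step (set prog) (f n) (f (Suc n))"
  shows "\<exists>ks. run ks \<and> honest ks"
proof -
  have "\<forall>n. \<exists>k. k < length prog \<and> fst (prog ! k) = fst (f n) \<and> snd (snd (prog ! k)) = fst (f (Suc n))
    \<and> enabled (fst (snd (prog ! k))) (snd (f n)) \<and> snd (f (Suc n)) = effect (fst (snd (prog ! k))) (snd (f n))"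
    using assms(2) unfolding step_def in_set_conv_nth by (metis fst_conv snd_conv)
  then obtain ks where ks: "\<And>n. ks n < length prog" "\<And>n. fst (prog ! ks n) = fst (f n)"
    "\<And>n. snd (snd (prog ! ks n)) = fst (f (Suc n))"
    "\<And>n. enabled (fst (snd (prog ! ks n))) (snd (f n))"
    "\<And>n. snd (f (Suc n)) = effect (fst (snd (prog ! ks n))) (snd (f n))"
    by metis
  have st: "stores (vec ks n) (snd (f n))" for n
  proof (induction n)
    case 0
    have "vec ks 0 = load s0" by (simp add: vec_def fun_eq_iff)
    then show ?case using stores_load assms(1) by simp
  next
    case (Suc n)
    have "vec ks (Suc n) = (\<lambda>i. vec ks n i + delta (fst (snd (prog ! ks n))) i)"
      by (simp add: fun_eq_iff vec_Suc)
    then show ?case using stores_effect[OF Suc ks(4)] ks(5) by simp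
  qed
  have "run ks" unfolding run_def using ks(1,2,3) assms(1) by simp
  moreover have "honest ks"
    unfolding honest_def vec_Suc using checks_iff_enabled[OF st] ks(4) by blast
  ultimately show ?thesis by blast
qed

text \<open>Every honest run arrives at state \<open>csize c\<close>, whose only instruction tests
  \<open>res\<close> for zero and jumps back to itself.\<close>

lemma honest_run_iff:
  assumes "exec c s0 s'"
  shows "(\<exists>ks. run ks \<and> honest ks) \<longleftrightarrow> s' res = 0"
proof
  have steps: "(step (set prog))\<^sup>*\<^sup>* (0, s0) (csize c, s')"
    using exec_steps[OF assms, of 0 "set prog"] by (auto simp: prog_def)
  {
    assume "\<exists>ks. run ks \<and> honest ks"
    then obtain ks where ks: "run ks" "honest ks" by blast
    obtain n where n: "fst (prog ! ks n) = csize c" "stores (vec ks n) s'"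
      using run_simulates[OF ks steps] by auto
    have "ks n < length prog" using ks(1) by (simp add: run_def)
    from nth_prog[OF this] have "(csize c, fst (snd (prog ! ks n)), snd (snd (prog ! ks n))) \<in> set prog"
      using n(1) by simp
    moreover have "a = IsZero res" if "(csize c, a, q) \<in> set prog" for a q
      using that code_range[of "csize c" a q c 0] by (auto simp: prog_def)
    ultimately have "fst (snd (prog ! ks n)) = IsZero res" by blast
    then have "enabled (IsZero res) s'"
      using checks_iff_enabled[OF n(2)] ks(2) unfolding honest_def vec_Suc by metis
    then show "s' res = 0" by simp
  next
    assume 0: "s' res = 0"
    have last: "step (set prog) (csize c, s') (csize c, s')"
      unfolding step_def prog_def using 0 by (intro exI[of _ "IsZero res"]) simp
    obtain m f where f: "f 0 = (0, s0)" "f m = (csize c, s')" "\<And>i. i < m \<Longrightarrow> step (set prog) (f i) (f (Suc i))"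
      using rtranclp_imp_relpowp[OF steps] unfolding relpowp_fun_conv by blast
    \<comment> \<open>From step \<open>m\<close> on the final loop repeats the last configuration
      forever.\<close>
    define g where "g i = f (min i m)" for i
    have "step (set prog) (g i) (g (Suc i))" for i
      using f last by (cases "i < m") (auto simp: g_def min_def not_less Suc_le_eq)
    moreover have "g 0 = (0, s0)" using f by (simp add: g_def)
    ultimately show "\<exists>ks. run ks \<and> honest ks" by (rule run_of_steps[rotated])
  }
qed

lemma arena_wf:
  assumes "\<forall>r\<in>insert res (regs c). r < K" "2 * K + length prog + csize c + 2 \<le> B"
  shows "arena_wf (2 * K + 1) (length prog) B (\<lambda>k. fst (prog ! k)) (\<lambda>k. snd (snd (prog ! k)))
    (\<lambda>k. checks (fst (snd (prog ! k))))"
proof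
  have total: "\<exists>k<length prog. fst (prog ! k) = q" if q: "q \<le> csize c" for q
  proof -
    have "\<exists>a q'. (q, a, q') \<in> set prog"
      using code_total[of 0 q c] q unfolding prog_def by (cases "q = csize c") auto
    then show ?thesis unfolding in_set_conv_nth by (metis fst_conv)
  qed
  have range: "fst (prog ! k) \<le> csize c \<and> snd (snd (prog ! k)) \<le> csize c" if "k < length prog" for k
  proof -
    have "q \<le> csize c \<and> q' \<le> csize c" if "(q, a, q') \<in> set prog" for q a q'
      using that code_range[of q a q' c 0] by (auto simp: prog_def)
    then show ?thesis using nth_prog[OF that] by blast
  qed
  show "\<exists>k<length prog. fst (prog ! k) = 0" using total by simp
  fix k assume k: "k < length prog"
  show "\<exists>k'<length prog. fst (prog ! k') = snd (snd (prog ! k))" using total range[OF k] by blast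
  show "fst (prog ! k) < B \<and> snd (snd (prog ! k)) < B" using range[OF k] assms(2) by linarith
  show "checks (fst (snd (prog ! k))) \<subseteq> {2..2 * K + 1}"
  proof -
    have "checks a \<subseteq> {2..2 * K + 1}" if "(q, a, q') \<in> set prog" for q a q'
      using that checks_code[of q a q' c 0 K] assms(1) by (auto simp: prog_def)
    then show ?thesis using nth_prog[OF k] by blast
  qed
qed (use assms in auto)

end

section \<open>Diagonalization\<close>

definition total_recursive :: "nat \<Rightarrow> (nat list \<Rightarrow> nat) \<Rightarrow> bool" where
  "total_recursive m F \<longleftrightarrow> (\<exists>f. \<forall>xs. length xs = m \<longrightarrow> eval f xs (F xs))"

lemma eval_Cn1: "eval g xs y \<Longrightarrow> eval f [y] z \<Longrightarrow> eval (Cn f [g]) xs z"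
  by (rule eval_Cn[of _ _ "[y]"]) auto

lemma eval_Cn2: "eval g xs y \<Longrightarrow> eval h xs y' \<Longrightarrow> eval f [y, y'] z \<Longrightarrow> eval (Cn f [g, h]) xs z"
  by (rule eval_Cn[of _ _ "[y, y']"]) auto

lemma eval_nth: "i < length xs \<Longrightarrow> y = xs ! i \<Longrightarrow> eval (Id i) xs y"
  using eval_Id by simp

lemma total_recursive_comp1:
  assumes "\<And>x. eval f [x] (h x)" "total_recursive m F"
  shows "total_recursive m (\<lambda>xs. h (F xs))"
  using assms eval_Cn1 unfolding total_recursive_def by meson

lemma total_recursive_comp2:
  assumes "\<And>x y. eval f [x, y] (h x y)" "total_recursive m F" "total_recursive m F'"
  shows "total_recursive m (\<lambda>xs. h (F xs) (F' xs))"
  using assms eval_Cn2 unfolding total_recursive_def by meson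

lemma total_recursive_Suc: "total_recursive m F \<Longrightarrow> total_recursive m (\<lambda>xs. Suc (F xs))"
  by (rule total_recursive_comp1[OF eval_S])

lemma total_recursive_const: "total_recursive m (\<lambda>_. k)"
proof (induction k)
  case 0
  show ?case using eval_Z unfolding total_recursive_def by blast
qed (rule total_recursive_Suc)

lemma total_recursive_nth: "i < m \<Longrightarrow> total_recursive m (\<lambda>xs. xs ! i)"
  using eval_Id unfolding total_recursive_def by blast

lemma eval_add: "eval (Pr (Id 0) (Cn S [Id 1])) [x, y] (x + y)"
proof (induction x)
  case 0
  show ?case by (rule eval_Pr0, rule eval_nth) simp_all
next
  case (Suc x)
  show ?case using Suc by (auto intro!: eval_PrS eval_Cn1 eval_S eval_nth)
qed

lemma eval_pred: "eval (Pr Z (Id 0)) [x] (x - 1)"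
proof (induction x)
  case 0
  show ?case by (auto intro: eval_Pr0 eval_Z)
next
  case (Suc x)
  show ?case by (rule eval_PrS[OF Suc]) (simp add: eval_nth)
qed

lemmas total_recursive_add = total_recursive_comp2[OF eval_add]

lemma eval_triangle:
  "eval (Pr Z (Cn (Pr (Id 0) (Cn S [Id 1])) [Id 1, Cn S [Id 0]])) [x] (triangle x)"
proof (induction x)
  case 0
  show ?case by (auto intro: eval_Pr0 eval_Z)
next
  case (Suc x)
  show ?case unfolding triangle_Suc
    by (rule eval_PrS[OF Suc], rule eval_Cn2[OF _ _ eval_add])
      (auto intro!: eval_Cn1 eval_S eval_nth)
qed

lemma total_recursive_prod_encode:
  "total_recursive m F \<Longrightarrow> total_recursive m F' \<Longrightarrow> total_recursive m (\<lambda>xs. prod_encode (F xs, F' xs))"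
  unfolding prod_encode_def prod.case
  by (intro total_recursive_add total_recursive_comp1[OF eval_triangle])

definition cons_code :: "nat \<Rightarrow> nat \<Rightarrow> nat" where
  "cons_code x y = Suc (prod_encode (x, y))"

lemma list_encode_Cons: "list_encode (x # xs) = cons_code x (list_encode xs)"
  by (simp add: cons_code_def)

lemma total_recursive_cons_code:
  "total_recursive m F \<Longrightarrow> total_recursive m F' \<Longrightarrow> total_recursive m (\<lambda>xs. cons_code (F xs) (F' xs))"
  unfolding cons_code_def by (intro total_recursive_Suc total_recursive_prod_encode)

text \<open>\<open>int_encode\<close> sends a natural number \<open>n\<close> to
  \<open>2 * n\<close> and, for positive \<open>n\<close>, its negation to \<open>2 * n - 1\<close>;
  at 0 truncated subtraction gives the right value.\<close>

lemma total_recursive_int_encode: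
  assumes "total_recursive m F"
  shows "total_recursive m (\<lambda>xs. int_encode (2 * int (F xs)))"
    and "total_recursive m (\<lambda>xs. int_encode (2 * - int (F xs)))"
proof -
  have 1: "int_encode (2 * int k) = (k + k) + (k + k)" for k
    by (simp add: int_encode_def sum_encode_def nat_mult_distrib)
  have 2: "int_encode (2 * - int k) = (k + k) + (k + k) - 1" for k
    by (cases k) (auto simp: int_encode_def sum_encode_def)
  show "total_recursive m (\<lambda>xs. int_encode (2 * int (F xs)))"
    unfolding 1 by (intro total_recursive_add assms)
  show "total_recursive m (\<lambda>xs. int_encode (2 * - int (F xs)))"
    unfolding 2 by (intro total_recursive_comp1[OF eval_pred] total_recursive_add assms)
qed

text \<open>Lets membership of a code in the decided set be read as a property of the instance
  itself.\<close>

lemma inj_encode: "encode I = encode J \<Longrightarrow> I = J"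
proof -
  have "inj enc_edge"
    unfolding inj_def enc_edge_def
    by (auto simp: list_encode_eq inj_map_eq_map[OF inj_int_encode])
  then show "encode I = encode J \<Longrightarrow> I = J"
    unfolding encode_def list_encode_eq
    by (cases I; cases J)
      (auto simp: list_encode_eq inj_map_eq_map inj_map_eq_map[OF inj_list_encode])
qed

section \<open>The code of the game as a recursive function\<close>

text \<open>Codes the weights of the start edge: 0 for components 0 and 1, two entries for each of
  registers 0 to 5, and then the tail \<open>xs ! 3\<close>, meant to be the code of the zeros for
  the remaining registers.\<close>

definition weights_code :: "nat list \<Rightarrow> nat" where
  "weights_code xs = cons_code (int_encode 0) (cons_code (int_encode 0)
     (foldr (\<lambda>i. cons_code (int_encode (2 * int (xs ! i)))
        \<circ> cons_code (int_encode (2 * - int (xs ! i)))) [0, 1, 2, 3, 4, 5] (xs ! 3)))"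

text \<open>The six numbers \<open>xs\<close> play a double role: they describe the arena apart from its starting
  edge, and they are the initial register contents, which are the weights of that edge.\<close>
definition arena_code :: "nat list \<Rightarrow> nat" where
  "arena_code xs = cons_code (xs ! 0) (cons_code 12 (cons_code (xs ! 1) (cons_code (xs ! 2)
     (cons_code
       (cons_code (cons_code 0 (cons_code 1 (cons_code (weights_code xs) 0))) (xs ! 4))
       (cons_code (xs ! 5) (cons_code 0 0))))))"

lemma total_recursive_arena_code: "total_recursive 6 arena_code"
proof -
  have "total_recursive 6 (\<lambda>xs. arena_code xs)"
    unfolding arena_code_def weights_code_def foldr.simps o_apply id_apply
    by (intro total_recursive_cons_code total_recursive_int_encode total_recursive_nth
        total_recursive_const) simp_all
  then show ?thesis by simp
qed

context counter_arena
begin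

text \<open>No entry involves \<open>s0\<close>, so the registers can be loaded with these very
  numbers without circularity. Of the \<open>2 * K + 2\<close> weights of the start edge 14 are
  explicit in \<open>weights_code\<close>, which leaves \<open>2 * K - 12\<close> zeros.\<close>

definition params :: "nat list" where
  "params = [6 * B, 2 * K + 1, list_encode (map own [0..<6 * B]),
     list_encode (replicate (2 * K - 12) 0),
     list_encode (map enc_edge other_edges), list_encode (map list_encode (map tgt [0..<2 * K + 2]))]"

lemma encode_G:
  assumes "6 \<le> K" "s0 = (\<lambda>r. if r < 6 then params ! r else 0)"
  shows "encode G = arena_code params"
proof -
  let ?w = "\<lambda>i. if 2 \<le> i then 2 * load s0 i else 0"
  \<comment> \<open>Components from 14 on belong to registers from 6 on, which start empty.\<close>
  have zero: "?w i = 0" if "14 \<le> i" for i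
  proof -
    have "\<not> (i - 2) div 2 < 6" "odd i \<Longrightarrow> \<not> (i - 3) div 2 < 6" using that by presburger+
    then show ?thesis unfolding assms(2) load_def by auto
  qed
  have split: "[0..<Suc (2 * K + 1)] = [0,1,2,3,4,5,6,7,8,9,10,11,12,13] @ [14..<Suc (2 * K + 1)]"
    using assms(1) by (simp add: upt_conv_Cons numeral_eq_Suc)
  have tail: "map ?w [14..<Suc (2 * K + 1)] = replicate (2 * K - 12) 0"
    using zero by (intro replicate_eqI) (auto simp del: upt_Suc)
  have i0: "int_encode 0 = 0" by (simp add: int_encode_def sum_encode_def)
  have load: "load s0 2 = int (s0 0)" "load s0 3 = - int (s0 0)" "load s0 4 = int (s0 1)"
    "load s0 5 = - int (s0 1)" "load s0 6 = int (s0 2)" "load s0 7 = - int (s0 2)"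
    "load s0 8 = int (s0 3)" "load s0 9 = - int (s0 3)" "load s0 10 = int (s0 4)"
    "load s0 11 = - int (s0 4)" "load s0 12 = int (s0 5)" "load s0 13 = - int (s0 5)"
    by (simp_all add: load_def)
  have s0: "s0 0 = params ! 0" "s0 1 = params ! 1" "s0 2 = params ! 2" "s0 3 = params ! 3"
    "s0 4 = params ! 4" "s0 5 = params ! 5"
    using assms(2) by simp_all
  have weights: "list_encode (map int_encode (map ?w [0..<Suc (2 * K + 1)])) = weights_code params"
  proof -
    have "map int_encode (map ?w [0..<Suc (2 * K + 1)]) = map int_encode
      [0, 0, 2 * int (params ! 0), 2 * - int (params ! 0), 2 * int (params ! 1), 2 * - int (params ! 1),
        2 * int (params ! 2), 2 * - int (params ! 2), 2 * int (params ! 3), 2 * - int (params ! 3),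
        2 * int (params ! 4), 2 * - int (params ! 4), 2 * int (params ! 5), 2 * - int (params ! 5)]
      @ replicate (2 * K - 12) 0"
      unfolding split map_append tail by (simp only: list.map load s0) (simp add: i0)
    moreover have "list_encode (replicate (2 * K - 12) 0) = params ! 3" by (simp add: params_def)
    ultimately show ?thesis unfolding weights_code_def
      by (simp only: append.simps list.map list_encode_Cons foldr.simps o_apply id_apply)
  qed
  have edge: "enc_edge start_edge = cons_code 0 (cons_code 1 (cons_code
     (list_encode (map int_encode (map ?w [0..<Suc (2 * K + 1)]))) 0))"
    by (simp only: enc_edge_def start_edge_def prod.case list_encode_Cons list_encode.simps(1))
  have p: "params ! 0 = 6 * B" "params ! 1 = 2 * K + 1" "params ! 2 = list_encode (map own [0..<6 * B])"
    "params ! 4 = list_encode (map enc_edge other_edges)"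
    "params ! 5 = list_encode (map list_encode (map tgt [0..<Suc (2 * K + 1)]))"
    by (simp_all add: params_def del: upt_Suc)
  have "venc (Gate 2) = 12" by simp
  then show ?thesis
    unfolding arena_code_def weights[symmetric] p
    unfolding encode_def G_def inst.sel list.map list_encode_Cons edge list_encode.simps(1)
    by (simp only:)
qed

end

section \<open>The self-referential game\<close>

text \<open>Treats both settings at once: about \<open>P\<close> only its meaning on these games
  matters, namely that an honest run exists.\<close>

lemma undecidable_arenas:
  fixes P :: "inst \<Rightarrow> bool" and ne :: bool
  assumes P: "\<And>t nT B src dst chk dlt x0. arena_wf t nT B src dst chk \<Longrightarrow>
    P (arena.G t nT B src dst chk dlt x0 ne) \<longleftrightarrow>
    (\<exists>ks. arena.run nT src dst ks \<and> arena.honest chk dlt x0 ks)"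
  shows "\<not> decidable_set {encode I | I. P I}"
proof
  let ?A = "{encode I | I. P I}"
  assume "decidable_set ?A"
  then obtain f where f: "\<And>n. eval f [n] (if n \<in> ?A then 1 else 0)"
    unfolding decidable_set_def by blast
  obtain g where g: "\<And>xs. length xs = 6 \<Longrightarrow> eval g xs (arena_code xs)"
    using total_recursive_arena_code unfolding total_recursive_def by blast
  \<comment> \<open>Registers 0 to 5 hold the description, register 6 receives the verdict of the
    decision procedure, and scratch space starts at 7.\<close>
  define c where "c = compile (Cn f [g]) [0..<6] 6 7"
  define K where "K = Suc (Max (insert 6 (regs c)))"
  define B where "B = 2 * K + length (counter_arena.prog c 6) + csize c + 2"
  \<comment> \<open>The program is fixed by now and mentions no register contents, so its own game
    can be described and loaded into its registers.\<close>
  define xs where "xs = counter_arena.params c 6 K B ne"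
  define s0 where "s0 r = (if r < 6 then xs ! r else 0)" for r
  interpret counter_arena c 6 K B ne s0 .
  have len: "length xs = 6" by (simp add: xs_def params_def)
  have K: "\<forall>r\<in>insert 6 (regs c). r < K"
    unfolding K_def using finite_regs by (auto simp: less_Suc_eq_le)
  have wf: "arena_wf (2 * K + 1) (length prog) B (\<lambda>k. fst (prog ! k)) (\<lambda>k. snd (snd (prog ! k)))
    (\<lambda>k. checks (fst (snd (prog ! k))))"
    by (rule arena_wf[OF K]) (simp add: B_def)
  have s0: "map s0 [0..<6] = xs"
    using len by (auto simp: s0_def intro!: nth_equalityI)
  have eval: "eval (Cn f [g]) xs (if arena_code xs \<in> ?A then 1 else 0)"
    by (rule eval_Cn1[OF g[OF len] f])
  from s0 obtain s' where s': "exec c s0 s'" "s' 6 = (if arena_code xs \<in> ?A then 1 else 0)"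
    unfolding c_def
    by (rule computesD[OF computes_all eval, of s0 "[0..<6]" 7 6]) (auto simp del: upt_Suc)
  have "encode G = arena_code xs"
    unfolding xs_def by (rule encode_G) (use K in \<open>auto simp: s0_def xs_def\<close>)
  \<comment> \<open>The program loops forever exactly on verdict 0, so \<open>P G\<close> holds
    exactly if the procedure denies it.\<close>
  then have "arena_code xs \<in> ?A \<longleftrightarrow> P G" using inj_encode by (smt (verit) mem_Collect_eq)
  also have "\<dots> \<longleftrightarrow> s' 6 = 0" using P[OF wf] honest_run_iff[OF s'(1)] by simp
  finally show False using s'(2) by (simp split: if_splits)
qed

theorem theorem4:
  shows "\<not> decidable_set {encode I | I. wf_ne I \<and> NCNS I}
       \<and> \<not> decidable_set {encode I | I. wf_po I \<and> NCPS I}"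
proof
  show "\<not> decidable_set {encode I | I. wf_ne I \<and> NCNS I}"
  proof (rule undecidable_arenas[where ne = True])
    fix t nT B src dst chk dlt x0
    assume "arena_wf t nT B src dst chk"
    then interpret arena_wf t nT B src dst chk dlt x0 True .
    show "wf_ne G \<and> NCNS G \<longleftrightarrow> (\<exists>ks. run ks \<and> honest ks)"
      using wf_ne_G NCNS_if_honest honest_if_NCNS by blast
  qed
  show "\<not> decidable_set {encode I | I. wf_po I \<and> NCPS I}"
  proof (rule undecidable_arenas[where ne = False])
    fix t nT B src dst chk dlt x0
    assume "arena_wf t nT B src dst chk"
    then interpret arena_wf t nT B src dst chk dlt x0 False .
    show "wf_po G \<and> NCPS G \<longleftrightarrow> (\<exists>ks. run ks \<and> honest ks)"
      using wf_po_G NCPS_if_honest honest_if_NCPS by blast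
  qed
qed

end
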